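(* The topological conjugacy relation of minimal invertible dynamical systems on tame cantoroids which are not homeomorphic to the Cantor space (i.e. conjugacy on the class of all pairs $(C,h)$ where $C$ is a tame cantoroid not homeomorphic to the Cantor space and $h:C\to C$ is a minimal homeomorphism) is Borel reducible to $E_{tt}(Q)^+$, where $Q=[0,1]^{\mathbb N}$ is the Hilbert cube.
   Context: All spaces are separable metrizable. A cantoroid is a nonempty compact space without isolated points such that the union of all degenerate (one-point) components is dense. A cantoroid is tame if all its nondegenerate components form a null sequence, i.e. their diameters tend to zero (for every $\varepsilon>0$ only finitely many components have diameter at least $\varepsilon$). Two systems $(X,T)$, $(Y,S)$ (compact metrizable space with a continuous self-map) are (topologically) conjugate if there is a homeomorphism $h:X\to Y$ with $h\circ T=S\circ h$. A system $(X,T)$ is minimal if every point $x\in X$ has a dense orbit $\{T^n(x):n\ge0\}$; it is invertible if $T$ is a homeomorphism. For a compact space $X$, $E_{tt}(X)$ is the equivalence relation on $X^{\mathbb N}$ in which $(a_n)_{n\in\mathbb N}$ is equivalent to $(a'_n)_{n\in\mathbb N}$ iff for every $n_1<n_2<\cdots$ the subsequence $(a_{n_k})_{k\in\mathbb N}$ is convergent if and only if $(a'_{n_k})_{k\in\mathbb N}$ is convergent. For an equivalence relation $E$ on a set $X$, $E^+$ is the equivalence relation on $X^{\mathbb N}$ in which $(a_n)$ and $(a'_n)$ are equivalent iff $\forall n\,\exists m:(a_n,a'_m)\in E$ and $\forall m\,\exists n:(a_n,a'_m)\in E$. Thus $E_{tt}(Q)^+$ is an equivalence relation on $(Q^{\mathbb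 N})^{\mathbb N}$. For equivalence relations $E$ on $X$ and $F$ on $Y$, where $X,Y$ are Polish (or standard Borel) spaces, $E$ is Borel reducible to $F$ if there is a Borel map $f:X\to Y$ with $x\,E\,x'\iff f(x)\,F\,f(x')$ for all $x,x'\in X$. Coding: for a compact space $Z$, let $\mathcal K(Z)$ be the space of nonempty compact subsets of $Z$ with the Vietoris topology. Up to conjugacy every system has its space $C\subseteq Q$, and such a system $(C,h)$ is coded by $C\in\mathcal K(Q)$ together with the graph of $h$ as an element of $\mathcal K(Q\times Q)$. *)

theory Defs
  imports "HOL-Analysis.Analysis"
begin

section \<open>Cantoroids\<close>

definition hilbert_cube :: "(nat \<Rightarrow> real) set" where
  "hilbert_cube = {x. \<forall>n. x n \<in> {0..1}}"

text \<open>Spaces are represented as subsets, with the subspace topology, of a metric ambient type.\<close>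

definition cantoroid :: "'a::metric_space set \<Rightarrow> bool" where
  "cantoroid C \<longleftrightarrow>
     C \<noteq> {} \<and> compact C \<and> (\<nexists>x. x isolated_in C) \<and>
     C \<subseteq> closure (\<Union>{D \<in> components C. is_singleton D})"

text \<open>For compact \<open>C\<close> the choice of the compatible metric is immaterial in the next definition.\<close>

definition tame_cantoroid :: "'a::metric_space set \<Rightarrow> bool" where
  "tame_cantoroid C \<longleftrightarrow>
     cantoroid C \<and> (\<forall>\<epsilon>>0. finite {D \<in> components C. diameter D \<ge> \<epsilon>})"

text \<open>The Cantor space, as the countable power of the two-point discrete space.\<close>

definition cantor_space :: "(nat \<Rightarrow> bool) set" where
  "cantor_space = UNIV"


section \<open>Dynamical systems\<close>

definition invertible_system :: "'a::metric_space set \<Rightarrow> ('a \<Rightarrow> 'a) \<Rightarrow> bool" where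
  "invertible_system C h \<longleftrightarrow> compact C \<and> (\<exists>g. homeomorphism C C h g)"

definition minimal_system :: "'a::metric_space set \<Rightarrow> ('a \<Rightarrow> 'a) \<Rightarrow> bool" where
  "minimal_system C h \<longleftrightarrow>
     compact C \<and> continuous_on C h \<and> h ` C \<subseteq> C \<and>
     (\<forall>x\<in>C. C \<subseteq> closure (range (\<lambda>n. (h ^^ n) x)))"

definition conjugate_systems ::
    "'a::metric_space set \<Rightarrow> ('a \<Rightarrow> 'a) \<Rightarrow> 'b::metric_space set \<Rightarrow> ('b \<Rightarrow> 'b) \<Rightarrow> bool" where
  "conjugate_systems X T Y S \<longleftrightarrow>
     (\<exists>\<phi> \<psi>. homeomorphism X Y \<phi> \<psi> \<and> (\<forall>x\<in>X. \<phi> (T x) = S (\<phi> x)))"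


section \<open>Spaces of compact sets and coding of systems\<close>

definition compacts :: "'a::topological_space set \<Rightarrow> 'a set set" where
  "compacts Z = {K. K \<noteq> {} \<and> compact K \<and> K \<subseteq> Z}"

definition vietoris :: "'a::topological_space set \<Rightarrow> 'a set topology" where
  "vietoris Z = topology_generated_by
     ({{K \<in> compacts Z. K \<subseteq> U} |U. open U} \<union> {{K \<in> compacts Z. K \<inter> U \<noteq> {}} |U. open U})"

definition graph_on :: "'a set \<Rightarrow> ('a \<Rightarrow> 'b) \<Rightarrow> ('a \<times> 'b) set" where
  "graph_on C h = {(x, h x) |x. x \<in> C}"

type_synonym system_code = "(nat \<Rightarrow> real) set \<times> ((nat \<Rightarrow> real) \<times> (nat \<Rightarrow> real)) set"

definition code_space :: "system_code topology" where
  "code_space = prod_topology (vietoris hilbert_cube) (vietoris (hilbert_cube \<times> hilbert_cube))"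

definition minimal_tame_codes :: "system_code set" where
  "minimal_tame_codes =
     {(C, graph_on C h) |C h.
        C \<subseteq> hilbert_cube \<and> tame_cantoroid C \<and> \<not> C homeomorphic cantor_space \<and>
        invertible_system C h \<and> minimal_system C h}"

definition conjugacy :: "system_code rel" where
  "conjugacy =
     {((C, graph_on C h), (C', graph_on C' h')) |C h C' h'.
        (C, graph_on C h) \<in> minimal_tame_codes \<and> (C', graph_on C' h') \<in> minimal_tame_codes \<and>
        conjugate_systems C h C' h'}"


section \<open>Equivalence relations and Borel reducibility\<close>

definition seqs :: "'a set \<Rightarrow> (nat \<Rightarrow> 'a) set" where
  "seqs A = {a. \<forall>n. a n \<in> A}"

text \<open>Convergence of a sequence in \<open>X\<close> means convergence to a point of \<open>X\<close>.\<close>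

definition E_tt :: "'a::topological_space set \<Rightarrow> (nat \<Rightarrow> 'a) rel" where
  "E_tt X = {(a, a'). a \<in> seqs X \<and> a' \<in> seqs X \<and>
     (\<forall>r. strict_mono (r :: nat \<Rightarrow> nat) \<longrightarrow>
        ((\<exists>l\<in>X. (a \<circ> r) \<longlonglongrightarrow> l) \<longleftrightarrow> (\<exists>l\<in>X. (a' \<circ> r) \<longlonglongrightarrow> l)))}"

text \<open>If \<open>E\<close> is an equivalence relation on \<open>A\<close>, the following is one on \<open>seqs A\<close>: the
  conditions force all terms to lie in the field of \<open>E\<close>.\<close>

definition jump :: "'a rel \<Rightarrow> (nat \<Rightarrow> 'a) rel" where
  "jump E = {(a, a'). (\<forall>n. \<exists>m. (a n, a' m) \<in> E) \<and> (\<forall>m. \<exists>n. (a n, a' m) \<in> E)}"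

definition borel_of :: "'a topology \<Rightarrow> 'a measure" where
  "borel_of X = sigma (topspace X) {U. openin X U}"

text \<open>
  Standard Borel spaces are presented as Borel subsets \<open>A\<close>, \<open>B\<close> of Polish spaces \<open>X\<close>, \<open>Y\<close>, with
  the induced Borel structure. That \<open>X\<close> and \<open>Y\<close> are Polish is not part of the predicate;
  \<open>code_space\<close> and the power \<open>seqs (seqs hilbert_cube)\<close> of the Hilbert cube are compact metrizable.
\<close>

definition borel_reducible ::
    "'a topology \<Rightarrow> 'a set \<Rightarrow> 'a rel \<Rightarrow> 'b topology \<Rightarrow> 'b set \<Rightarrow> 'b rel \<Rightarrow> bool" where
  "borel_reducible X A E Y B F \<longleftrightarrow>
     A \<in> sets (borel_of X) \<and> B \<in> sets (borel_of Y) \<and> equiv A E \<and> equiv B F \<and>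
     (\<exists>f \<in> measurable (restrict_space (borel_of X) A) (restrict_space (borel_of Y) B).
        \<forall>x\<in>A. \<forall>x'\<in>A. (x, x') \<in> E \<longleftrightarrow> (f x, f x') \<in> F)"

end

theory Submission
  imports Defs
begin

text \<open>
  A nondegenerate component \<open>D\<close> of a minimal tame cantoroid is not periodic, so by tameness the
  diameters of its iterates tend to zero and all points of \<open>D\<close> have \<open>E_tt\<close>-equivalent orbits.
  Conversely, a dense orbit determines the system up to conjugacy by the \<open>E_tt\<close>-class of the orbit.
  Tameness leaves only countably many nondegenerate components, and there is at least one when the
  space is not the Cantor space, by Brouwer's theorem. So a system is classified by the countable set
  of \<open>E_tt\<close>-classes of the orbits of its nondegenerate components.

  For the Borel part, countably many clopen splittings (\<open>cuts\<close>) isolate each component of diameter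
  at least \<open>1 / (k + 1)\<close>. Lying in a common component of \<open>C\<close> is a closed relation in \<open>C\<close> and the two
  points, and projection along a compact space preserves closedness; hence every condition needed
  is a countable Boolean combination of closed ones. The orbit of a component is only followed
  approximately, through a countable dense set, which avoids choosing a point in it.
\<close>

section \<open>Clopen splittings\<close>

text \<open>Only nondegenerate components are followed, because they form a countable set attached
  to the system; points in general have uncountably many orbits. A conjugacy need not respect any
  chosen component, so all are listed, and the jump forgets order and repetition. Size is measured
  by pairs of points instead of diameters: a point is big if its component has a second point at
  distance at least \<open>1 / (k + 1)\<close>. This is closed in the code and the two points, and a
  component of diameter at least \<open>1 / (k + 1)\<close> contains such a point because its
  diameter is attained. The clopen subsets of a varying space admit no common list, whereas pairs of
  disjoint finite unions of basic open sets of the ambient space do; such a pair splits every set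
  that it covers. A list indexed by all thresholds and cuts has entries that select no component.
  They hold a constant sequence, which cannot be mistaken for an orbit: an orbit equivalent to it
  would converge, to a fixed point, and a minimal system with more than one point has none.\<close>

definition base :: "'a::second_countable_topology set set" where
  "base = (SOME B. countable B \<and> topological_basis B)"

lemma base: "countable base" "topological_basis base"
  using someI_ex[OF ex_countable_basis] unfolding base_def by blast+

text \<open>Finite unions are included so that a compact set, and not only a point, has arbitrarily
  small neighbourhoods in a countable family.\<close>

definition ubase :: "'a::second_countable_topology set set" where
  "ubase = Union ` {F. finite F \<and> F \<subseteq> base}"

lemma countable_ubase: "countable (ubase :: 'a::second_countable_topology set set)"
  unfolding ubase_def using base(1) by (intro countable_image countable_Collect_finite_subset)

lemma open_ubase: "U \<in> ubase \<Longrightarrow> open U"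
  unfolding ubase_def using topological_basis_open[OF base(2)] by (auto intro!: open_Union)

lemma ubase_between:
  fixes K :: "'a::second_countable_topology set"
  assumes "compact K" "open U" "K \<subseteq> U"
  obtains V where "V \<in> ubase" "K \<subseteq> V" "V \<subseteq> U"
proof -
  obtain B where B: "B \<subseteq> base" "\<Union>B = U"
    using base(2) \<open>open U\<close> unfolding topological_basis_def by metis
  then have "K \<subseteq> \<Union>B" "\<And>T. T \<in> B \<Longrightarrow> open T"
    using assms(3) topological_basis_open[OF base(2)] by auto
  then obtain F where F: "F \<subseteq> B" "finite F" "K \<subseteq> \<Union>F"
    using compactE[OF assms(1)] by metis
  then have "\<Union>F \<in> ubase" using B(1) unfolding ubase_def by blast
  then show thesis
    using that[of "\<Union>F"] F B(2) by blast
qed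

lemma ubase_point:
  assumes "open U" "x \<in> U"
  obtains V where "V \<in> ubase" "x \<in> V" "V \<subseteq> U"
  using ubase_between[of "{x}" U] assms by auto

text \<open>The pairs live in the ambient space and mention no \<open>C\<close>. One countable
  family therefore serves for all compact sets at once; a pair describes a clopen splitting of
  exactly those sets that it covers.\<close>

definition cuts :: "('a::second_countable_topology set \<times> 'a set) set" where
  "cuts = {(V, W). V \<in> ubase \<and> W \<in> ubase \<and> V \<inter> W = {}}"

lemma countable_cuts: "countable cuts"
  by (rule countable_subset[of _ "ubase \<times> ubase"]) (auto simp: cuts_def countable_ubase)

lemma cutsD:
  assumes "(V, W) \<in> cuts"
  shows "open V" "open W" "V \<inter> W = {}" "W \<inter> V = {}"
  using assms open_ubase unfolding cuts_def by auto

lemma cut_connected_component: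
  assumes "(V, W) \<in> cuts" "C \<subseteq> V \<union> W" "connected_component C x y" "x \<in> V"
  shows "y \<in> V"
proof -
  obtain T where T: "connected T" "T \<subseteq> C" "x \<in> T" "y \<in> T"
    using assms(3) unfolding connected_component_def by blast
  have "V \<inter> T = {} \<or> W \<inter> T = {}"
    by (rule connectedD[OF T(1)]) (use cutsD[OF assms(1)] T assms(2) in blast)+
  then show ?thesis using T assms by blast
qed

text \<open>Normality separates the two compact sets; each neighbourhood is then shrunk to a member
  of \<open>ubase\<close>.\<close>

lemma clopen_cut:
  fixes A :: "'a::{metric_space, second_countable_topology} set"
  assumes "compact A" "compact B" "A \<inter> B = {}" "A \<subseteq> U" "open U"
  obtains V W where "(V, W) \<in> cuts" "A \<subseteq> V" "V \<subseteq> U" "B \<subseteq> W"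
proof -
  obtain V' W' where VW: "open V'" "open W'" "A \<subseteq> V'" "B \<subseteq> W'" "V' \<inter> W' = {}"
    using t4_space[of A B] assms(1-3) compact_imp_closed by metis
  obtain V where V: "V \<in> ubase" "A \<subseteq> V" "V \<subseteq> V' \<inter> U"
    using ubase_between[of A "V' \<inter> U"] assms VW by auto
  obtain W where W: "W \<in> ubase" "B \<subseteq> W" "W \<subseteq> W'"
    using ubase_between[of B W'] assms VW by auto
  show thesis
    using that[of V W] V W VW unfolding cuts_def by blast
qed

text \<open>In a compact Hausdorff space the components are the quasi-components.\<close>

lemma component_cut:
  fixes C :: "'a::{metric_space, second_countable_topology} set"
  assumes C: "compact C" and x: "x \<in> C"
    and U: "connected_component_set C x \<subseteq> U" "open U"
  obtains V W where "(V, W) \<in> cuts" "C \<subseteq> V \<union> W" "connected_component_set C x \<subseteq> V" "V \<subseteq> U"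
proof -
  define D where "D = connected_component_set C x"
  have D: "compact D" "D \<in> components C"
    unfolding D_def using C x closed_connected_component[OF compact_imp_closed[OF C]]
      compact_Int_closed[OF C] connected_component_subset[of C x]
    by (auto simp: components_def, metis Int_absorb1)
  have DC: "D \<subseteq> C" "disjnt D (C - U)"
    using U connected_component_subset[of C x] unfolding D_def disjnt_iff by blast+
  \<comment> \<open>The component is separated from the part of \<open>C\<close> outside
    \<open>U\<close>, so that the clopen set found below lies in \<open>U\<close>.\<close>
  have "separated_between (top_of_set C) D (C - U)"
  proof (subst separated_between_compact_connected_component)
    show "D \<in> connected_components_of (top_of_set C)"
      using x by (auto simp: connected_components_of_def D_def connected_component_of_def
          connected_component_def connectedin_subtopology)
    show "locally_compact_space (top_of_set C)"
      using C by (simp add: compact_imp_locally_compact_space compact_space_subtopology)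
    show "closedin (top_of_set C) (C - U)"
      using U(2) C by (simp add: closedin_compact_eq compact_diff)
  qed (use D(1) DC in \<open>auto simp: Hausdorff_space_subtopology compactin_subtopology\<close>)
  then obtain A where A: "closedin (top_of_set C) A" "openin (top_of_set C) A" "D \<subseteq> A" "C - U \<subseteq> C - A"
    unfolding separated_between by auto
  have AC: "A \<subseteq> C" using A(2) openin_imp_subset by blast
  have "compact A" using A(1) C closedin_compact by blast
  moreover have "compact (C - A)"
    using closedin_compact[OF C] closedin_diff[OF _ A(2)] by simp
  moreover have "A \<inter> (C - A) = {}" "A \<subseteq> U" using A(4) AC by auto
  ultimately obtain V W where VW: "(V, W) \<in> cuts" "A \<subseteq> V" "V \<subseteq> U" "C - A \<subseteq> W"
    using clopen_cut U(2) by metis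
  have "C \<subseteq> V \<union> W" using VW by blast
  moreover have "connected_component_set C x \<subseteq> V" using A(3) VW(2) unfolding D_def by simp
  ultimately show thesis using that VW by simp
qed

lemma separate_cut:
  fixes C :: "'a::{metric_space, second_countable_topology} set"
  assumes "compact C" "x \<in> C" "y \<in> C" "\<not> connected_component C x y"
  obtains V W where "(V, W) \<in> cuts" "C \<subseteq> V \<union> W" "x \<in> V" "y \<in> W"
proof -
  obtain V W where *: "(V, W) \<in> cuts" "C \<subseteq> V \<union> W" "connected_component_set C x \<subseteq> V" "V \<subseteq> - {y}"
    using component_cut[OF assms(1,2), of "- {y}"] assms by auto
  then show thesis
    using that[of V W] assms(2,3) connected_component_refl[of x C] by blast
qed

lemma compact_decseq:
  fixes F :: "nat \<Rightarrow> 'a::t2_space set"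
  assumes F: "\<And>n. compact (F n)" "\<And>n. F n \<noteq> {}" and dec: "\<And>m n. m \<le> n \<Longrightarrow> F n \<subseteq> F m"
  shows "(\<Inter>n. F n) \<noteq> {}"
proof -
  have "F 0 \<inter> (\<Inter>n\<in>UNIV. F n) \<noteq> {}"
  proof (rule compact_imp_fip_image[OF F(1)])
    fix I :: "nat set" assume I: "finite I"
    have "F (Max (insert 0 I)) \<subseteq> F n" if "n \<in> insert 0 I" for n
      using I that by (intro dec Max_ge) auto
    then have "F (Max (insert 0 I)) \<subseteq> F 0 \<inter> (\<Inter>n\<in>I. F n)" by blast
    then show "F 0 \<inter> (\<Inter>n\<in>I. F n) \<noteq> {}" using F(2) by blast
  qed (use F compact_imp_closed in auto)
  then show ?thesis by auto
qed

section \<open>Brouwer's characterization of the Cantor space\<close>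

text \<open>Points receive addresses in a binary tree of nonempty clopen pieces. Diameters are not
  controlled: two points are told apart once a clopen set separating them has had its turn in the
  enumeration \<open>A\<close>. Compactness makes every branch nonempty.\<close>

theorem Brouwer_cantor_space:
  fixes C :: "'a::{metric_space, second_countable_topology} set"
  assumes C: "compact C" "C \<noteq> {}" and perfect: "\<nexists>x. x isolated_in C"
    and disc: "\<And>x y. connected_component C x y \<Longrightarrow> x = y"
  shows "C homeomorphic cantor_space"
proof -
  define clp where "clp A \<longleftrightarrow> openin (top_of_set C) A \<and> openin (top_of_set C) (C - A)" for A
  have cut_clp: "clp (C \<inter> V)" if "(V, W) \<in> cuts" "C \<subseteq> V \<union> W" for V W
  proof -
    have "C - C \<inter> V = C \<inter> W" using that cutsD[OF that(1)] by auto
    then show ?thesis using cutsD[OF that(1)] by (auto simp: clp_def openin_open_Int)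
  qed
  have clp_subset: "A \<subseteq> C" if "clp A" for A
    using that openin_imp_subset unfolding clp_def by auto
  have clp_open: "\<exists>T. open T \<and> A = C \<inter> T" if "clp A" for A
    using that[unfolded clp_def] openin_open[of C A] by simp
  have clp_Int: "clp (A \<inter> B)" if "clp A" "clp B" for A B
    using that openin_Int[of "top_of_set C" A B] openin_Un[of "top_of_set C" "C - A" "C - B"]
    unfolding clp_def by (simp add: Diff_Int)
  have clp_Diff: "clp (A - B)" if "clp A" "clp B" for A B
  proof -
    have "clp (C - B)"
      using that(2) clp_subset[OF that(2)] unfolding clp_def by (simp add: double_diff)
    moreover have "A \<inter> (C - B) = A - B" using clp_subset[OF that(1)] by blast
    ultimately show ?thesis using clp_Int[OF that(1)] by metis
  qed
  have clp_closed: "compact A" if "clp A" for A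
    using that C(1) closedin_compact[of C A] clp_subset[OF that]
    unfolding clp_def closedin_def by auto
  \<comment> \<open>The traces of cuts separate points because all components are degenerate;
    \<open>C\<close> is added so that the countable family is visibly nonempty and can be
    enumerated.\<close>
  define \<A> where "\<A> = insert C {C \<inter> V |V W. (V, W) \<in> cuts \<and> C \<subseteq> V \<union> W}"
  have "\<A> \<subseteq> insert C ((\<lambda>(V, W). C \<inter> V) ` cuts)" unfolding \<A>_def by auto
  then have "countable \<A>" by (rule countable_subset) (simp add: countable_cuts)
  moreover have "\<A> \<noteq> {}" by (simp add: \<A>_def)
  ultimately obtain A :: "nat \<Rightarrow> 'a set" where A: "range A = \<A>"
    using range_from_nat_into[of \<A>] by metis
  have clp_C: "clp C" unfolding clp_def by simp
  have clp_A: "clp (A n)" for n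
  proof -
    have "A n \<in> \<A>" using A by blast
    then show ?thesis using cut_clp clp_C unfolding \<A>_def by auto
  qed
  have sep: "\<exists>n. x \<in> A n \<and> y \<notin> A n" if xy: "x \<in> C" "y \<in> C" "x \<noteq> y" for x y
  proof -
    obtain V W where VW: "(V, W) \<in> cuts" "C \<subseteq> V \<union> W" "x \<in> V" "y \<in> W"
      using separate_cut[OF C(1) xy(1,2)] disc xy by metis
    then have "C \<inter> V \<in> range A" unfolding A unfolding \<A>_def by blast
    then obtain n where "A n = C \<inter> V" by (metis rangeE)
    then show ?thesis using VW cutsD[OF VW(1)] xy by blast
  qed
  \<comment> \<open>\<open>P B n\<close> is one of the two halves of \<open>B\<close>: it agrees with \<open>B \<inter> A n\<close> when the latter is a proper
    part, so that after the \<open>n\<close>-th splitting no piece crosses \<open>A n\<close>.\<close>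
  have split: "\<exists>P. clp P \<and> P \<subseteq> B \<and> P \<noteq> {} \<and> P \<noteq> B \<and> (P = B \<inter> A n \<or> B \<inter> A n = {} \<or> B \<subseteq> A n)"
    if B: "clp B" "B \<noteq> {}" for B n
  proof (cases "B \<inter> A n = {} \<or> B \<subseteq> A n")
    case False
    then show ?thesis using clp_Int[OF B(1) clp_A, of n] by (intro exI[of _ "B \<inter> A n"]) auto
  next
    case True
    obtain x where x: "x \<in> B" using B by auto
    obtain T where T: "open T" "B = C \<inter> T" using clp_open[OF B(1)] by metis
    \<comment> \<open>Otherwise the open set \<open>B\<close> would be an isolated point. When
      \<open>A n\<close> does not cut \<open>B\<close>, two points of \<open>B\<close> still allow a
      proper splitting by some other \<open>A k\<close>.\<close>
    have "\<exists>y\<in>B. y \<noteq> x"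
    proof (rule ccontr)
      assume "\<not> (\<exists>y\<in>B. y \<noteq> x)"
      then have "B = {x}" using x by blast
      then have "T \<inter> C = {x}" using T(2) by (simp add: Int_commute)
      then have "x isolated_in C" using T(1) by (intro isolated_inI[of x C T]) auto
      then show False using perfect by simp
    qed
    then obtain y where y: "y \<in> B" "y \<noteq> x" by blast
    then obtain k where "x \<in> A k" "y \<notin> A k" using sep[of x y] x clp_subset[OF B(1)] by blast
    then show ?thesis using True x y clp_Int[OF B(1) clp_A, of k] by (intro exI[of _ "B \<inter> A k"]) auto
  qed
  obtain P where P: "\<And>B n. clp B \<Longrightarrow> B \<noteq> {} \<Longrightarrow> clp (P B n) \<and> P B n \<subseteq> B \<and> P B n \<noteq> {} \<and> P B n \<noteq> B \<and>
      (P B n = B \<inter> A n \<or> B \<inter> A n = {} \<or> B \<subseteq> A n)"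
    using split by metis
  define F where "F \<sigma> = rec_nat C (\<lambda>n B. if \<sigma> n then P B n else B - P B n)" for \<sigma> :: "nat \<Rightarrow> bool"
  have F_Suc: "F \<sigma> (Suc n) = (if \<sigma> n then P (F \<sigma> n) n else F \<sigma> n - P (F \<sigma> n) n)"
    and F_0: "F \<sigma> 0 = C" for \<sigma> n
    by (simp_all add: F_def)
  have F: "clp (F \<sigma> n) \<and> F \<sigma> n \<noteq> {}" for \<sigma> n
  proof (induction n)
    case 0
    show ?case using clp_C C by (simp add: F_0)
  next
    case (Suc n)
    then show ?case using P[of "F \<sigma> n" n] clp_Diff by (auto simp: F_Suc)
  qed
  have F_cong: "F \<sigma> n = F \<tau> n" if "\<And>k. k < n \<Longrightarrow> \<sigma> k = \<tau> k" for \<sigma> \<tau> n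
    using that by (induction n) (auto simp: F_0 F_Suc)
  have F_dec: "F \<sigma> (Suc n) \<subseteq> F \<sigma> n" for \<sigma> n
    using P F by (auto simp: F_Suc)
  have F_resolve: "F \<sigma> (Suc n) \<subseteq> A n \<or> F \<sigma> (Suc n) \<inter> A n = {}" for \<sigma> n
  proof -
    consider "P (F \<sigma> n) n = F \<sigma> n \<inter> A n" | "F \<sigma> n \<inter> A n = {}" | "F \<sigma> n \<subseteq> A n"
      using P F by blast
    then show ?thesis by cases (use F_dec[of \<sigma> n] in \<open>auto simp: F_Suc split: if_splits\<close>)
  qed
  \<comment> \<open>The address of \<open>x\<close> is read off while descending, so the recursion
    carries the current piece \<open>B\<close>; \<open>\<phi> x\<close> is then defined from it, and
    \<open>E x\<close> turns out to be the branch \<open>F (\<phi> x)\<close>.\<close>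
  define E where "E x = rec_nat C (\<lambda>n B. if x \<in> P B n then P B n else B - P B n)" for x
  define \<phi> where "\<phi> x n \<longleftrightarrow> x \<in> P (E x n) n" for x n
  have E_Suc: "E x (Suc n) = (if \<phi> x n then P (E x n) n else E x n - P (E x n) n)"
    and E_0: "E x 0 = C" for x n
    by (simp_all add: E_def \<phi>_def)
  have E: "E x n = F (\<phi> x) n" for x n
    by (induction n) (simp_all only: F_0 F_Suc E_0 E_Suc)
  have mem: "x \<in> F (\<phi> x) n" if "x \<in> C" for x n
  proof (induction n)
    case 0
    then show ?case using that by (simp add: F_0)
  next
    case (Suc n)
    then show ?case using \<phi>_def[of x n] E[of x n] by (simp add: F_Suc)
  qed
  \<comment> \<open>Pieces of level \<open>n\<close> are the cylinders of length \<open>n\<close>.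
    This yields both the continuity of each digit and the surjectivity.\<close>
  have mem_iff: "x \<in> F \<sigma> n \<longleftrightarrow> (\<forall>k<n. \<phi> x k = \<sigma> k)" if x: "x \<in> C" for x \<sigma> n
  proof (induction n)
    case 0
    then show ?case using x by (simp add: F_0)
  next
    case (Suc n)
    show ?case
    proof (cases "x \<in> F \<sigma> n")
      case True
      then have "\<forall>k<n. \<phi> x k = \<sigma> k" using Suc by blast
      then have "F (\<phi> x) n = F \<sigma> n" by (intro F_cong) auto
      then have "\<phi> x n \<longleftrightarrow> x \<in> P (F \<sigma> n) n" by (simp add: \<phi>_def E)
      then show ?thesis using True Suc P[of "F \<sigma> n" n] F[of \<sigma> n] by (auto simp: F_Suc less_Suc_eq)
    next
      case False
      then show ?thesis using Suc F_dec[of \<sigma> n] by (auto simp: less_Suc_eq)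
    qed
  qed
  have inj: "inj_on \<phi> C"
  proof (rule inj_onI, rule ccontr)
    fix x y assume xy: "x \<in> C" "y \<in> C" "\<phi> x = \<phi> y" "x \<noteq> y"
    obtain n where n: "x \<in> A n" "y \<notin> A n" using sep[OF xy(1,2,4)] by blast
    have "x \<in> F (\<phi> x) (Suc n)" "y \<in> F (\<phi> x) (Suc n)"
      using mem[OF xy(1)] mem[OF xy(2)] unfolding xy(3) by blast+
    then show False using F_resolve[of "\<phi> x" n] n by blast
  qed
  have surj: "\<phi> ` C = UNIV"
  proof (intro set_eqI iffI UNIV_I)
    fix \<sigma>
    have "(\<Inter>n. F \<sigma> n) \<noteq> {}"
    proof (rule compact_decseq)
      show "F \<sigma> n \<subseteq> F \<sigma> m" if "m \<le> n" for m n
        using that by (rule lift_Suc_antimono_le[of "F \<sigma>", OF F_dec])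
    qed (use F clp_closed in auto)
    then obtain x where x: "\<And>n. x \<in> F \<sigma> n" by blast
    then have "x \<in> C" using F_0[of \<sigma>] by blast
    have "\<phi> x k = \<sigma> k" for k
      using x[of "Suc k"] mem_iff[OF \<open>x \<in> C\<close>, of \<sigma> "Suc k"] by simp
    then have "\<phi> x = \<sigma>" by blast
    then show "\<sigma> \<in> \<phi> ` C" using \<open>x \<in> C\<close> by blast
  qed
  have "continuous_on C \<phi>"
  proof (rule continuous_on_coordinatewise_then_product)
    fix n
    show "continuous_on C (\<lambda>x. \<phi> x n)"
      unfolding continuous_on_topological
    proof (intro ballI allI impI)
      fix x B assume x: "x \<in> C" and "\<phi> x n \<in> B"
      obtain T where T: "open T" "F (\<phi> x) (Suc n) = C \<inter> T"
        using clp_open F by metis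
      have "\<phi> y n = \<phi> x n" if "y \<in> C" "y \<in> T" for y
        using mem_iff[OF that(1), of "\<phi> x" "Suc n"] that T(2) by simp
      moreover have "x \<in> T" using mem[OF x, of "Suc n"] T(2) by simp
      ultimately show "\<exists>A. open A \<and> x \<in> A \<and> (\<forall>y\<in>C. y \<in> A \<longrightarrow> \<phi> y n \<in> B)"
        using T(1) \<open>\<phi> x n \<in> B\<close> by (intro exI[of _ T] conjI ballI impI) simp_all
    qed
  qed
  then have cont: "continuous_on C \<phi>" .
  \<comment> \<open>The Hausdorff property of the power makes the compact images of closed sets
    closed, so the continuous bijection is a homeomorphism.\<close>
  have "Hausdorff_space (product_topology (\<lambda>_::nat. euclidean :: bool topology) UNIV)"
    unfolding Hausdorff_space_product_topology
    by (rule disjI2) (simp only: Hausdorff_space_def disjnt_def open_openin[symmetric], metis hausdorff)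
  then have "Hausdorff_space (euclidean :: (nat \<Rightarrow> bool) topology)"
    by (simp only: euclidean_product_topology)
  then have "closedin euclidean (\<phi> ` U)" if "closedin (top_of_set C) U" for U
    using compact_continuous_image[OF continuous_on_subset[OF cont] closedin_compact[OF C(1) that]]
      closedin_imp_subset[OF that] by (intro compactin_imp_closedin) auto
  then obtain \<psi> where "homeomorphism C UNIV \<phi> \<psi>"
    using homeomorphism_injective_closed_map[OF cont surj inj] by auto
  then show ?thesis unfolding cantor_space_def homeomorphic_def by blast
qed

section \<open>Orbits and the relation \<open>E_tt\<close>\<close>

lemma filtermap_strict_mono:
  assumes "strict_mono (r :: nat \<Rightarrow> nat)"
  shows "filtermap r sequentially = inf sequentially (principal (range r))"
proof (rule filter_eqI)
  fix P
  show "eventually P (filtermap r sequentially) = eventually P (inf sequentially (principal (range r)))"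
    unfolding eventually_filtermap eventually_inf_principal eventually_sequentially
  proof
    assume "\<exists>N. \<forall>n\<ge>N. P (r n)"
    then obtain N where N: "\<forall>n\<ge>N. P (r n)" ..
    then have "\<forall>n\<ge>r N. n \<in> range r \<longrightarrow> P n"
      using strict_mono_less_eq[OF assms] by auto
    then show "\<exists>N. \<forall>n\<ge>N. n \<in> range r \<longrightarrow> P n" ..
  next
    assume "\<exists>N. \<forall>n\<ge>N. n \<in> range r \<longrightarrow> P n"
    then obtain N where N: "\<forall>n\<ge>N. n \<in> range r \<longrightarrow> P n" ..
    then have "\<forall>n\<ge>N. P (r n)"
      using strict_mono_imp_increasing[OF assms] by (meson le_trans rangeI)
    then show "\<exists>N. \<forall>n\<ge>N. P (r n)" ..
  qed
qed

text \<open>A subsequence matters only through the set of its indices. In this form, merging two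
  subsequences means forming the supremum of two filters.\<close>

lemma LIMSEQ_strict_mono_iff:
  assumes "strict_mono r"
  shows "(a \<circ> r) \<longlonglongrightarrow> l \<longleftrightarrow> (a \<longlongrightarrow> l) (inf sequentially (principal (range r)))"
  unfolding filterlim_filtermap[symmetric] filtermap_strict_mono[OF assms, symmetric]
  by (simp add: filterlim_filtermap o_def)

text \<open>This is what makes limits well defined later: two subsequences with the same limit are
  parts of one convergent subsequence.\<close>

lemma merge_subsequences:
  fixes r s :: "nat \<Rightarrow> nat"
  assumes "strict_mono r" "strict_mono s" "(a \<circ> r) \<longlonglongrightarrow> l" "(a \<circ> s) \<longlonglongrightarrow> l"
  obtains t where "strict_mono t" "(a \<circ> t) \<longlonglongrightarrow> l" "range t = range r \<union> range s"
proof -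
  have "infinite (range r \<union> range s)"
    using assms(1) by (simp add: finite_image_iff strict_mono_on_imp_inj_on)
  then obtain t :: "nat \<Rightarrow> nat" where t: "strict_mono t" "range t = range r \<union> range s"
    using strict_mono_enumerate range_enumerate by metis
  have "(a \<longlongrightarrow> l) (sup (inf sequentially (principal (range r))) (inf sequentially (principal (range s))))"
    using assms by (simp add: LIMSEQ_strict_mono_iff filterlim_sup)
  then have "(a \<circ> t) \<longlonglongrightarrow> l"
    using t by (simp add: LIMSEQ_strict_mono_iff inf_sup_distrib1[symmetric])
  then show thesis using that t by blast
qed

lemma LIMSEQ_subset_range:
  fixes r t :: "nat \<Rightarrow> nat"
  assumes "strict_mono r" "strict_mono t" "range r \<subseteq> range t" "(a \<circ> t) \<longlonglongrightarrow> l"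
  shows "(a \<circ> r) \<longlonglongrightarrow> l"
proof -
  have le: "inf sequentially (principal (range r)) \<le> inf sequentially (principal (range t))"
    using assms(3) by (intro inf_mono) auto
  show ?thesis
    using tendsto_mono[OF le] assms(4)
    unfolding LIMSEQ_strict_mono_iff[OF assms(1)] LIMSEQ_strict_mono_iff[OF assms(2)] by blast
qed

text \<open>The right side is closed by its form, and it matches the density of orbit tails in a
  minimal system.\<close>

lemma cluster_point_iff:
  fixes z :: "nat \<Rightarrow> 'a::metric_space"
  shows "(\<exists>r. strict_mono r \<and> (z \<circ> r) \<longlonglongrightarrow> l) \<longleftrightarrow> l \<in> (\<Inter>N. closure (z ` {N..}))"
proof
  assume "\<exists>r. strict_mono r \<and> (z \<circ> r) \<longlonglongrightarrow> l"
  then obtain r where r: "strict_mono r" "(z \<circ> r) \<longlonglongrightarrow> l" by blast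
  have "\<exists>y\<in>z ` {N..}. dist y l < e" if "e > 0" for e N
  proof -
    obtain M where "\<forall>n\<ge>M. dist ((z \<circ> r) n) l < e" using metric_LIMSEQ_D[OF r(2) \<open>e > 0\<close>] by blast
    then have "dist (z (r (max M N))) l < e" by simp
    moreover have "r (max M N) \<ge> N" using strict_mono_imp_increasing[OF r(1), of "max M N"] by simp
    ultimately show ?thesis by auto
  qed
  then show "l \<in> (\<Inter>N. closure (z ` {N..}))" by (simp add: closure_approachable)
next
  assume l: "l \<in> (\<Inter>N. closure (z ` {N..}))"
  have ex: "\<exists>m\<ge>N. dist (z m) l < 1 / Suc k" for N k
  proof -
    have "l \<in> closure (z ` {N..})" using l by blast
    then have "\<exists>y\<in>z ` {N..}. dist y l < 1 / Suc k" unfolding closure_approachable by simp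
    then show ?thesis by auto
  qed
  have "\<exists>r. \<forall>k. dist (z (r k)) l < 1 / Suc k \<and> r k < r (Suc k)"
  proof (rule dependent_nat_choice)
    show "\<exists>m. dist (z m) l < 1 / Suc 0" using ex[of 0 0] by auto
    show "\<exists>y. dist (z y) l < 1 / Suc (Suc n) \<and> x < y" for x n
      using ex[of "Suc x" "Suc n"] by auto
  qed
  then obtain r where r: "\<And>k. dist (z (r k)) l < 1 / Suc k" "\<And>k. r k < r (Suc k)" by blast
  have "(\<lambda>k. dist ((z \<circ> r) k) l) \<longlonglongrightarrow> 0"
    using less_imp_le[OF r(1)]
    by (intro tendsto_sandwich[OF _ _ tendsto_const lim_inverse_n'[THEN LIMSEQ_Suc]] always_eventually)
      (simp_all add: o_def)
  then have "(z \<circ> r) \<longlonglongrightarrow> l" by (rule iffD2[OF tendsto_dist_iff])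
  moreover have "strict_mono r" using r(2) by (simp add: strict_mono_Suc_iff)
  ultimately show "\<exists>r. strict_mono r \<and> (z \<circ> r) \<longlonglongrightarrow> l" by blast
qed

section \<open>Orbits of minimal systems and \<open>E_tt\<close>\<close>

lemma iterate_in: "h ` C \<subseteq> C \<Longrightarrow> x \<in> C \<Longrightarrow> (h ^^ n) x \<in> C"
  by (induction n) auto

lemma minimal_systemD:
  assumes "minimal_system C h"
  shows "compact C" "continuous_on C h" "h ` C \<subseteq> C" "x \<in> C \<Longrightarrow> (h ^^ n) x \<in> C"
    "x \<in> C \<Longrightarrow> C \<subseteq> closure (range (\<lambda>n. (h ^^ n) x))"
  using assms iterate_in[of h C] unfolding minimal_system_def by auto

lemma minimal_closed_invariant:
  assumes "minimal_system C h" "closed A" "x \<in> A" "x \<in> C" "h ` (A \<inter> C) \<subseteq> A"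
  shows "C \<subseteq> A"
proof -
  note m = minimal_systemD[OF assms(1)]
  have "(h ^^ n) x \<in> A \<inter> C" for n
    using m(3) assms by (induction n) auto
  then have "closure (range (\<lambda>n. (h ^^ n) x)) \<subseteq> A"
    using \<open>closed A\<close> by (intro closure_minimal) auto
  then show ?thesis using m(5)[OF \<open>x \<in> C\<close>] by blast
qed

lemma E_tt_sym: "(a, b) \<in> E_tt X \<Longrightarrow> (b, a) \<in> E_tt X"
  unfolding E_tt_def by auto

lemma E_tt_trans: "(a, b) \<in> E_tt X \<Longrightarrow> (b, c) \<in> E_tt X \<Longrightarrow> (a, c) \<in> E_tt X"
  unfolding E_tt_def by auto

lemma E_tt_refl: "a \<in> seqs X \<Longrightarrow> (a, a) \<in> E_tt X"
  unfolding E_tt_def by auto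

text \<open>The limits along a common subsequence even coincide. The lemma absorbs two kinds of
  error later: moving to another point of the same component, and approximating by a dense
  sequence.\<close>

lemma E_tt_asymptotic:
  fixes a b :: "nat \<Rightarrow> 'a::metric_space"
  assumes "a \<in> seqs X" "b \<in> seqs X" "(\<lambda>n. dist (a n) (b n)) \<longlonglongrightarrow> 0"
  shows "(a, b) \<in> E_tt X"
proof -
  have *: "(v \<circ> r) \<longlonglongrightarrow> l"
    if "strict_mono r" "(u \<circ> r) \<longlonglongrightarrow> l" "(\<lambda>n. dist (u n) (v n)) \<longlonglongrightarrow> 0" for u v :: "nat \<Rightarrow> 'a" and r l
  proof -
    have lim: "(\<lambda>n. dist ((u \<circ> r) n) l + dist (u (r n)) (v (r n))) \<longlonglongrightarrow> 0"
      using LIMSEQ_subseq_LIMSEQ[OF that(3,1)] that(2) tendsto_dist_iff[of "u \<circ> r" l]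
      by (intro tendsto_add_zero) (simp_all add: o_def)
    have le: "dist ((v \<circ> r) n) l \<le> dist ((u \<circ> r) n) l + dist (u (r n)) (v (r n))" for n
      using dist_triangle[of "v (r n)" l "u (r n)"] by (simp add: dist_commute)
    have "(\<lambda>n. dist ((v \<circ> r) n) l) \<longlonglongrightarrow> 0"
      by (rule tendsto_sandwich[OF _ _ tendsto_const lim]) (use le in simp_all)
    then show ?thesis by (rule iffD2[OF tendsto_dist_iff])
  qed
  have "(\<lambda>n. dist (b n) (a n)) \<longlonglongrightarrow> 0" using assms(3) by (simp add: dist_commute)
  then have "(a \<circ> r) \<longlonglongrightarrow> l \<longleftrightarrow> (b \<circ> r) \<longlonglongrightarrow> l" if "strict_mono r" for r l
    using *[OF that, of a l b] *[OF that, of b l a] assms(3) by blast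
  then show ?thesis using assms(1,2) unfolding E_tt_def by simp
qed

text \<open>Homeomorphisms of compact sets preserve convergence of subsequences in both directions.
  For the orbits, convergence in \<open>Q\<close> is the same as convergence in \<open>X\<close> or
  in \<open>Y\<close>, since these are closed.\<close>

lemma E_tt_conjugate:
  fixes X Y Q :: "'a::metric_space set"
  assumes "homeomorphism X Y \<phi> \<psi>" "\<And>x. x \<in> X \<Longrightarrow> \<phi> (T x) = S (\<phi> x)"
    and X: "minimal_system X T" "X \<subseteq> Q" and Y: "minimal_system Y S" "Y \<subseteq> Q" and x: "x \<in> X"
  shows "(\<lambda>n. (T ^^ n) x, \<lambda>n. (S ^^ n) (\<phi> x)) \<in> E_tt Q"
proof -
  note mX = minimal_systemD[OF X(1)] note mY = minimal_systemD[OF Y(1)]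
  note hom = homeomorphism_image1[OF assms(1)] homeomorphism_apply1[OF assms(1)]
    homeomorphism_cont1[OF assms(1)] homeomorphism_cont2[OF assms(1)]
  have \<phi>: "\<phi> ((T ^^ n) x) = (S ^^ n) (\<phi> x)" for n
    using assms(2) mX(4)[OF x] by (induction n) auto
  have \<psi>: "\<psi> ((S ^^ n) (\<phi> x)) = (T ^^ n) x" for n
    using \<phi>[of n] hom(2)[OF mX(4)[OF x]] by metis
  have \<phi>x: "\<phi> x \<in> Y" using hom(1) x by blast
  have lim: "\<exists>l'\<in>Q. ((\<lambda>n. g (u n)) \<circ> r) \<longlonglongrightarrow> l'"
    if "compact A" "continuous_on A g" "g ` A \<subseteq> B" "B \<subseteq> Q" "\<And>n. u n \<in> A" "(u \<circ> r) \<longlonglongrightarrow> l"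
    for A B g l and u :: "nat \<Rightarrow> 'a" and r
  proof -
    have "l \<in> A"
      using closed_sequentially[OF compact_imp_closed[OF that(1)], of "u \<circ> r" l] that by auto
    then have "((\<lambda>n. g ((u \<circ> r) n))) \<longlonglongrightarrow> g l"
      using that by (intro continuous_on_tendsto_compose[OF that(2,6)]) auto
    then show ?thesis using \<open>l \<in> A\<close> that by (auto simp: o_def)
  qed
  have "(\<exists>l\<in>Q. ((\<lambda>n. (T ^^ n) x) \<circ> r) \<longlonglongrightarrow> l) \<longleftrightarrow> (\<exists>l\<in>Q. ((\<lambda>n. (S ^^ n) (\<phi> x)) \<circ> r) \<longlonglongrightarrow> l)" for r
  proof
    assume "\<exists>l\<in>Q. ((\<lambda>n. (T ^^ n) x) \<circ> r) \<longlonglongrightarrow> l"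
    then show "\<exists>l\<in>Q. ((\<lambda>n. (S ^^ n) (\<phi> x)) \<circ> r) \<longlonglongrightarrow> l"
      using lim[where u = "\<lambda>n. (T ^^ n) x", OF mX(1) hom(3) _ Y(2) mX(4)[OF x]] hom(1)
      unfolding \<phi> by blast
  next
    assume "\<exists>l\<in>Q. ((\<lambda>n. (S ^^ n) (\<phi> x)) \<circ> r) \<longlonglongrightarrow> l"
    then show "\<exists>l\<in>Q. ((\<lambda>n. (T ^^ n) x) \<circ> r) \<longlonglongrightarrow> l"
      using lim[where u = "\<lambda>n. (S ^^ n) (\<phi> x)", OF mY(1) hom(4) _ X(2) mY(4)[OF \<phi>x]]
        homeomorphism_image2[OF assms(1)]
      unfolding \<psi> by blast
  qed
  then show ?thesis
    using mX(4)[OF x] mY(4)[OF \<phi>x] X(2) Y(2) unfolding E_tt_def seqs_def by blast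
qed

text \<open>The conjugacy is the set of cluster points of the pair of orbits.\<close>

lemma conjugate_of_E_tt:
  fixes X Y Q :: "'a::metric_space set"
  assumes X: "minimal_system X T" "X \<subseteq> Q" and Y: "minimal_system Y S" "Y \<subseteq> Q"
    and x: "x \<in> X" and y: "y \<in> Y"
    and E: "(\<lambda>n. (T ^^ n) x, \<lambda>n. (S ^^ n) y) \<in> E_tt Q"
  shows "conjugate_systems X T Y S"
proof -
  note mX = minimal_systemD[OF X(1)] note mY = minimal_systemD[OF Y(1)]
  define a where "a n = (T ^^ n) x" for n
  define b where "b n = (S ^^ n) y" for n
  have aX: "a n \<in> X" and bY: "b n \<in> Y" for n
    using mX(4)[OF x] mY(4)[OF y] by (simp_all add: a_def b_def)
  have E': "(\<exists>l\<in>Q. (a \<circ> r) \<longlonglongrightarrow> l) \<longleftrightarrow> (\<exists>l\<in>Q. (b \<circ> r) \<longlonglongrightarrow> l)" if "strict_mono r" for r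
    using E that unfolding E_tt_def a_def[abs_def] b_def[abs_def] by blast
  define \<Gamma> where "\<Gamma> = {p. \<exists>r. strict_mono r \<and> ((\<lambda>n. (a n, b n)) \<circ> r) \<longlonglongrightarrow> p}"
  have \<Gamma>_iff: "(u, v) \<in> \<Gamma> \<longleftrightarrow> (\<exists>r. strict_mono r \<and> (a \<circ> r) \<longlonglongrightarrow> u \<and> (b \<circ> r) \<longlonglongrightarrow> v)" for u v
  proof -
    have "((\<lambda>n. (a n, b n)) \<circ> r) \<longlonglongrightarrow> (u, v) \<longleftrightarrow> (a \<circ> r) \<longlonglongrightarrow> u \<and> (b \<circ> r) \<longlonglongrightarrow> v" for r
      using tendsto_fst[of "\<lambda>n. (a (r n), b (r n))" "(u, v)"] tendsto_snd[of "\<lambda>n. (a (r n), b (r n))" "(u, v)"]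
      by (auto simp: o_def intro: tendsto_Pair)
    then show ?thesis unfolding \<Gamma>_def by simp
  qed
  have \<Gamma>_sub: "\<Gamma> \<subseteq> X \<times> Y"
  proof
    fix p assume p: "p \<in> \<Gamma>"
    obtain u v where uv: "p = (u, v)" by fastforce
    obtain r where "(a \<circ> r) \<longlonglongrightarrow> u" "(b \<circ> r) \<longlonglongrightarrow> v" using p unfolding uv \<Gamma>_iff by blast
    then show "p \<in> X \<times> Y"
      using closed_sequentially[OF compact_imp_closed[OF mX(1)], of "a \<circ> r" u] aX
        closed_sequentially[OF compact_imp_closed[OF mY(1)], of "b \<circ> r" v] bY uv by auto
  qed
  have "\<Gamma> = (\<Inter>N. closure ((\<lambda>n. (a n, b n)) ` {N..}))"
    unfolding \<Gamma>_def using cluster_point_iff[of "\<lambda>n. (a n, b n)"] by blast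
  then have "closed \<Gamma>" by (simp add: closed_INT)
  then have cpt: "compact \<Gamma>"
    using compact_Int_closed[OF compact_Times[OF mX(1) mY(1)], of \<Gamma>] \<Gamma>_sub by (simp add: Int_absorb1)
  \<comment> \<open>Every point is a cluster point of every orbit, because minimality also applies
    to the orbit started at time \<open>N\<close>.\<close>
  have tail: "u \<in> (\<Inter>N. closure ((\<lambda>n. (h ^^ n) z) ` {N..}))"
    if "minimal_system A h" "z \<in> A" "u \<in> A" for A u z and h :: "'a \<Rightarrow> 'a"
  proof
    fix N
    have "range (\<lambda>n. (h ^^ n) ((h ^^ N) z)) \<subseteq> (\<lambda>n. (h ^^ n) z) ` {N..}"
      by (auto simp: funpow_add[symmetric, unfolded o_def fun_eq_iff, rule_format] intro!: image_eqI)
    moreover have "u \<in> closure (range (\<lambda>n. (h ^^ n) ((h ^^ N) z)))"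
      using minimal_systemD[OF that(1)] that by blast
    ultimately show "u \<in> closure ((\<lambda>n. (h ^^ n) z) ` {N..})"
      using closure_mono by blast
  qed
  have img1: "fst ` \<Gamma> = X"
  proof
    show "fst ` \<Gamma> \<subseteq> X" using \<Gamma>_sub by auto
    show "X \<subseteq> fst ` \<Gamma>"
    proof
      fix u assume u: "u \<in> X"
      then obtain r where r: "strict_mono r" "(a \<circ> r) \<longlonglongrightarrow> u"
        using tail[OF X(1) x u] cluster_point_iff[of a u] unfolding a_def[abs_def] by blast
      then obtain v where "(b \<circ> r) \<longlonglongrightarrow> v" using E'[OF r(1)] u X(2) by blast
      then have "(u, v) \<in> \<Gamma>" using r \<Gamma>_iff by blast
      then show "u \<in> fst ` \<Gamma>" by force
    qed
  qed
  have img2: "snd ` \<Gamma> = Y"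
  proof
    show "snd ` \<Gamma> \<subseteq> Y" using \<Gamma>_sub by auto
    show "Y \<subseteq> snd ` \<Gamma>"
    proof
      fix v assume v: "v \<in> Y"
      then obtain r where r: "strict_mono r" "(b \<circ> r) \<longlonglongrightarrow> v"
        using tail[OF Y(1) y v] cluster_point_iff[of b v] unfolding b_def[abs_def] by blast
      then obtain u where "(a \<circ> r) \<longlonglongrightarrow> u" using E'[OF r(1)] v Y(2) by blast
      then have "(u, v) \<in> \<Gamma>" using r \<Gamma>_iff by blast
      then show "v \<in> snd ` \<Gamma>" by force
    qed
  qed
  \<comment> \<open>Subsequences along which \<open>c\<close> has the same limit \<open>u\<close>
    merge into one along which \<open>c\<close> still converges. Then \<open>d\<close> converges
    along the merged one too, so its limits along the two parts agree. Used in both directions, this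
    makes \<open>\<Gamma>\<close> the graph of a bijection.\<close>
  have uniq: "v1 = v2"
    if r: "strict_mono r" "(c \<circ> r) \<longlonglongrightarrow> u" "(d \<circ> r) \<longlonglongrightarrow> v1"
      and s: "strict_mono s" "(c \<circ> s) \<longlonglongrightarrow> u" "(d \<circ> s) \<longlonglongrightarrow> v2" and u: "u \<in> Q"
      and cd: "\<And>t. strict_mono t \<Longrightarrow> (\<exists>l\<in>Q. (c \<circ> t) \<longlonglongrightarrow> l) \<Longrightarrow> (\<exists>l\<in>Q. (d \<circ> t) \<longlonglongrightarrow> l)"
    for c d :: "nat \<Rightarrow> 'a" and r s u v1 v2
  proof -
    obtain t where t: "strict_mono t" "(c \<circ> t) \<longlonglongrightarrow> u" "range t = range r \<union> range s"
      using merge_subsequences[OF r(1) s(1) r(2) s(2)] by blast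
    then obtain v where v: "(d \<circ> t) \<longlonglongrightarrow> v" using cd u by blast
    have "(d \<circ> r) \<longlonglongrightarrow> v" "(d \<circ> s) \<longlonglongrightarrow> v"
      using LIMSEQ_subset_range[OF r(1) t(1) _ v] LIMSEQ_subset_range[OF s(1) t(1) _ v] t(3) by auto
    then show ?thesis using r(3) s(3) LIMSEQ_unique by blast
  qed
  have fun1: "v1 = v2" if "(u, v1) \<in> \<Gamma>" "(u, v2) \<in> \<Gamma>" for u v1 v2
  proof -
    have "u \<in> Q" using that(1) \<Gamma>_sub X(2) by blast
    then show ?thesis using that E' uniq[of _ a u b v1 _ v2] unfolding \<Gamma>_iff by metis
  qed
  have fun2: "u1 = u2" if "(u1, v) \<in> \<Gamma>" "(u2, v) \<in> \<Gamma>" for u1 u2 v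
  proof -
    have "v \<in> Q" using that(1) \<Gamma>_sub Y(2) by blast
    then show ?thesis using that E' uniq[of _ b v a u1 _ u2] unfolding \<Gamma>_iff by metis
  qed
  have "inj_on fst \<Gamma>" using fun1 by (intro inj_onI) (metis prod.collapse)
  then obtain p where p: "homeomorphism \<Gamma> X fst p"
    using homeomorphism_compact[OF cpt continuous_on_fst[OF continuous_on_id] img1] by blast
  have "inj_on snd \<Gamma>" using fun2 by (intro inj_onI) (metis prod.collapse)
  then obtain q where q: "homeomorphism \<Gamma> Y snd q"
    using homeomorphism_compact[OF cpt continuous_on_snd[OF continuous_on_id] img2] by blast
  have hom: "homeomorphism X Y (snd \<circ> p) (fst \<circ> q)"
    using homeomorphism_compose[OF homeomorphism_symD[OF p] q] .
  \<comment> \<open>Shifting the subsequence by one index shows that \<open>\<Gamma>\<close> is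
    invariant under \<open>T\<close> and \<open>S\<close> acting together, which is the equivariance
    of the map it describes.\<close>
  have step: "(T u, S v) \<in> \<Gamma>" if uv: "(u, v) \<in> \<Gamma>" for u v
  proof -
    obtain r where r: "strict_mono r" "(a \<circ> r) \<longlonglongrightarrow> u" "(b \<circ> r) \<longlonglongrightarrow> v" using uv \<Gamma>_iff by blast
    have uvXY: "u \<in> X" "v \<in> Y" using uv \<Gamma>_sub by auto
    have "(\<lambda>n. T ((a \<circ> r) n)) \<longlonglongrightarrow> T u"
      using aX uvXY by (intro continuous_on_tendsto_compose[OF mX(2) r(2)]) auto
    then have "(a \<circ> (\<lambda>n. Suc (r n))) \<longlonglongrightarrow> T u" by (simp add: a_def o_def)
    moreover have "(\<lambda>n. S ((b \<circ> r) n)) \<longlonglongrightarrow> S v"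
      using bY uvXY by (intro continuous_on_tendsto_compose[OF mY(2) r(3)]) auto
    then have "(b \<circ> (\<lambda>n. Suc (r n))) \<longlonglongrightarrow> S v" by (simp add: b_def o_def)
    moreover have "strict_mono (\<lambda>n. Suc (r n))" using r(1) by (simp add: strict_mono_def)
    ultimately show ?thesis using \<Gamma>_iff by blast
  qed
  have p\<Gamma>: "(u, (snd \<circ> p) u) \<in> \<Gamma>" if "u \<in> X" for u
  proof -
    have "p u \<in> \<Gamma>" using homeomorphism_image2[OF p] that by blast
    moreover have "fst (p u) = u" using homeomorphism_apply2[OF p that] .
    ultimately show ?thesis by (metis comp_apply prod.collapse)
  qed
  have "(snd \<circ> p) (T u) = S ((snd \<circ> p) u)" if "u \<in> X" for u
    using fun1[OF p\<Gamma> step[OF p\<Gamma>]] that mX(3) by blast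
  then show ?thesis unfolding conjugate_systems_def using hom by blast
qed

section \<open>Tame cantoroids\<close>

lemma connected_component_image:
  assumes "connected_component S x y" "continuous_on S f" "f ` S \<subseteq> T"
  shows "connected_component T (f x) (f y)"
proof -
  obtain K where K: "connected K" "K \<subseteq> S" "x \<in> K" "y \<in> K"
    using assms(1) unfolding connected_component_def by blast
  have "connected (f ` K)"
    using connected_continuous_image[OF continuous_on_subset[OF assms(2) K(2)] K(1)] .
  then show ?thesis
    unfolding connected_component_def using K assms(3) by (intro exI[of _ "f ` K"]) auto
qed

lemma compact_component:
  assumes "compact (C :: 'a::t2_space set)" "D \<in> components C"
  shows "compact D"
  using assms closed_components compact_imp_closed in_components_subset compact_Int_closed
  by (metis inf.absorb2)

lemma component_eq:
  assumes "D \<in> components C" "x \<in> D"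
  shows "D = connected_component_set C x"
proof -
  obtain z where "D = connected_component_set C z" using assms(1) unfolding components_def by blast
  then show ?thesis using connected_component_eq[of x C z] assms(2) by simp
qed

text \<open>Two points of \<open>C \<inter> U\<close> are separated by disjoint sets of
  \<open>ubase\<close> inside \<open>U\<close>. Only conditions that \<open>C\<close> meets given
  open sets remain, and these are open in the Vietoris topology.\<close>

lemma perfect_iff:
  fixes C :: "'a::{metric_space, second_countable_topology} set"
  shows "(\<nexists>x. x isolated_in C) \<longleftrightarrow> (\<forall>U\<in>ubase. C \<inter> U \<noteq> {} \<longrightarrow>
    (\<exists>V\<in>ubase. \<exists>W\<in>ubase. V \<inter> W = {} \<and> V \<subseteq> U \<and> W \<subseteq> U \<and> C \<inter> V \<noteq> {} \<and> C \<inter> W \<noteq> {}))"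
    (is "?L \<longleftrightarrow> ?R")
proof
  assume L: ?L
  show ?R
  proof (intro ballI impI)
    fix U assume U: "U \<in> ubase" "C \<inter> U \<noteq> {}"
    then obtain x where x: "x \<in> C" "x \<in> U" by blast
    have "U \<inter> C \<noteq> {x}" using L open_ubase[OF U(1)] x unfolding isolated_in_def by blast
    then obtain y where y: "y \<in> C" "y \<in> U" "y \<noteq> x" using x by blast
    obtain V' W' where VW: "open V'" "open W'" "x \<in> V'" "y \<in> W'" "V' \<inter> W' = {}"
      using hausdorff[of x y] y by metis
    obtain V where V: "V \<in> ubase" "x \<in> V" "V \<subseteq> V' \<inter> U"
      using ubase_point[of "V' \<inter> U" x] VW(1,3) x(2) open_ubase[OF U(1)] by (metis IntI open_Int)
    obtain W where W: "W \<in> ubase" "y \<in> W" "W \<subseteq> W' \<inter> U"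
      using ubase_point[of "W' \<inter> U" y] VW(2,4) y(2) open_ubase[OF U(1)] by (metis IntI open_Int)
    have "V \<inter> W = {}" "V \<subseteq> U" "W \<subseteq> U" "C \<inter> V \<noteq> {}" "C \<inter> W \<noteq> {}"
      using V W VW(5) x(1) y(1) by auto
    then show "\<exists>V\<in>ubase. \<exists>W\<in>ubase. V \<inter> W = {} \<and> V \<subseteq> U \<and> W \<subseteq> U \<and> C \<inter> V \<noteq> {} \<and> C \<inter> W \<noteq> {}"
      using V(1) W(1) by blast
  qed
next
  assume R: ?R
  show ?L
  proof
    assume "\<exists>x. x isolated_in C"
    then obtain x T where x: "x \<in> C" "open T" "T \<inter> C = {x}" unfolding isolated_in_def by blast
    then obtain U where U: "U \<in> ubase" "x \<in> U" "U \<subseteq> T" using ubase_point[of T x] by blast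
    then have "C \<inter> U \<noteq> {}" using x(1) by blast
    with R U(1) obtain V W where VW: "V \<inter> W = {}" "V \<subseteq> U" "W \<subseteq> U" "C \<inter> V \<noteq> {}" "C \<inter> W \<noteq> {}"
      by (metis (lifting))
    have "C \<inter> U \<subseteq> {x}" using U(3) x(3) by auto
    then have "x \<in> V" "x \<in> W" using VW by auto
    then show False using VW(1) by blast
  qed
qed

lemma degenerate_components:
  "\<Union>{D \<in> components C. is_singleton D} = {x \<in> C. \<forall>y. connected_component C x y \<longrightarrow> y = x}"
proof (intro set_eqI iffI)
  fix x assume "x \<in> \<Union>{D \<in> components C. is_singleton D}"
  then obtain D where D: "D \<in> components C" "is_singleton D" "x \<in> D" by blast
  then have "D = {x}" "x \<in> C" using in_components_subset[OF D(1)] by (auto simp: is_singleton_def)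
  then have "connected_component_set C x = {x}"
    using component_eq[OF D(1,3)] by simp
  with \<open>x \<in> C\<close> show "x \<in> {x \<in> C. \<forall>y. connected_component C x y \<longrightarrow> y = x}" by blast
next
  fix x assume x: "x \<in> {x \<in> C. \<forall>y. connected_component C x y \<longrightarrow> y = x}"
  then have "connected_component_set C x = {x}" by auto
  moreover have "connected_component_set C x \<in> components C" using x by (auto simp: components_def)
  ultimately show "x \<in> \<Union>{D \<in> components C. is_singleton D}"
    by (intro UnionI[of "{x}"]) (auto simp: is_singleton_def)
qed

definition small :: "nat \<Rightarrow> 'a::metric_space set \<Rightarrow> bool" where
  "small n V \<longleftrightarrow> (\<forall>x\<in>V. \<forall>y\<in>V. dist x y \<le> 1 / Suc n)"

text \<open>Baire category. At each scale \<open>n\<close> the points lying in a small clopen piece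
  form an open subset of \<open>C\<close>, dense by the right side. So the points with this property
  at every scale are dense, and their components are degenerate.\<close>

lemma dense_degenerate_iff:
  fixes C :: "'a::{metric_space, second_countable_topology} set"
  assumes C: "compact C"
  shows "C \<subseteq> closure (\<Union>{D \<in> components C. is_singleton D}) \<longleftrightarrow>
    (\<forall>n. \<forall>U\<in>ubase. C \<inter> U \<noteq> {} \<longrightarrow> (\<exists>(V, W)\<in>cuts. small n V \<and> C \<subseteq> V \<union> W \<and> C \<inter> (V \<inter> U) \<noteq> {}))"
    (is "?L \<longleftrightarrow> ?R")
proof
  assume L: ?L
  show ?R
  proof (intro allI ballI impI)
    fix n U assume U: "U \<in> ubase" "C \<inter> U \<noteq> {}"
    then have "U \<inter> closure (\<Union>{D \<in> components C. is_singleton D}) \<noteq> {}" using L by blast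
    then have "U \<inter> \<Union>{D \<in> components C. is_singleton D} \<noteq> {}"
      using open_Int_closure_eq_empty[OF open_ubase[OF U(1)]] by blast
    then obtain x where x: "x \<in> U" "x \<in> C" "connected_component_set C x \<subseteq> {x}"
      unfolding degenerate_components by blast
    \<comment> \<open>The radius is half the required bound, since two points of \<open>V\<close>
      are compared through the centre \<open>x\<close>.\<close>
    have "connected_component_set C x \<subseteq> ball x (1 / (2 * Suc n))" using x(3) by auto
    then obtain V W where VW: "(V, W) \<in> cuts" "C \<subseteq> V \<union> W" "connected_component_set C x \<subseteq> V"
        "V \<subseteq> ball x (1 / (2 * Suc n))"
      using component_cut[OF C x(2) _ open_ball] by metis
    have "dist u v \<le> 1 / Suc n" if "u \<in> V" "v \<in> V" for u v
    proof -
      have "dist x u < 1 / (2 * Suc n)" "dist x v < 1 / (2 * Suc n)" using that VW(4) by auto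
      then have "dist u v < 1 / (2 * Suc n) + 1 / (2 * Suc n)"
        using dist_triangle3[of u v x] by linarith
      then show ?thesis by (simp add: field_simps)
    qed
    then have "small n V" unfolding small_def by blast
    moreover have "x \<in> V" using VW(3) x(2) connected_component_refl[of x C] by blast
    ultimately show "\<exists>(V, W)\<in>cuts. small n V \<and> C \<subseteq> V \<union> W \<and> C \<inter> (V \<inter> U) \<noteq> {}"
      using VW(1,2) x(1,2) by blast
  qed
next
  assume R: ?R
  define X where "X = top_of_set C"
  define G where "G n = C \<inter> \<Union>{V. \<exists>W. (V, W) \<in> cuts \<and> small n V \<and> C \<subseteq> V \<union> W}" for n
  have X: "locally_compact_space X" "regular_space X"
    unfolding X_def using C
    by (auto simp: compact_space_subtopology intro!: compact_imp_locally_compact_space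
        intro: regular_space_subtopology metrizable_imp_regular_space metrizable_space_subtopology
          metrizable_space_euclidean)
  have "X closure_of \<Inter>(range G) = topspace X"
  proof (rule Baire_category[OF disjI2[OF conjI[OF X]]])
    fix T assume "T \<in> range G"
    then obtain n where T: "T = G n" by blast
    have "open (\<Union>{V. \<exists>W. (V, W) \<in> cuts \<and> small n V \<and> C \<subseteq> V \<union> W})"
      using cutsD(1) by (intro open_Union) auto
    then have "openin X T" unfolding T G_def X_def by (rule openin_open_Int)
    moreover have "x \<in> closure (G n)" if x: "x \<in> C" for x
    proof (rule ccontr)
      assume "x \<notin> closure (G n)"
      then obtain U where U: "U \<in> ubase" "x \<in> U" "U \<subseteq> - closure (G n)"
        using ubase_point[of "- closure (G n)" x] by auto
      then obtain V W where VW: "(V, W) \<in> cuts" "small n V" "C \<subseteq> V \<union> W" "C \<inter> (V \<inter> U) \<noteq> {}"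
        using R x by blast
      then obtain y where y: "y \<in> C" "y \<in> V" "y \<in> U" by blast
      then have "y \<in> G n" using VW unfolding G_def by blast
      then show False using y(3) U(3) closure_subset by blast
    qed
    ultimately show "openin X T \<and> X closure_of T = topspace X"
      unfolding T X_def by (auto simp: closure_of_subtopology G_def)
  qed simp
  then have "C \<subseteq> closure (\<Inter>(range G))"
    using closure_mono[of "C \<inter> \<Inter>(range G)" "\<Inter>(range G)"]
    unfolding X_def by (auto simp: closure_of_subtopology)
  also have "\<Inter>(range G) \<subseteq> \<Union>{D \<in> components C. is_singleton D}"
    unfolding degenerate_components
  proof safe
    fix x assume x: "x \<in> \<Inter>(range G)"
    then show "x \<in> C" unfolding G_def by blast
    fix y assume y: "connected_component C x y"
    have "dist x y \<le> 1 / Suc n" for n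
    proof -
      have "x \<in> G n" using x by blast
      then obtain V W where "(V, W) \<in> cuts" "small n V" "C \<subseteq> V \<union> W" "x \<in> V"
        unfolding G_def by blast
      then show ?thesis using cut_connected_component[of V W C x y] y unfolding small_def by blast
    qed
    then have "dist x y \<le> 0"
      by (intro LIMSEQ_le_const[OF LIMSEQ_inverse_real_of_nat]) (auto simp: inverse_eq_divide)
    then show "y = x" by simp
  qed
  then have "closure (\<Inter>(range G)) \<subseteq> closure (\<Union>{D \<in> components C. is_singleton D})"
    by (rule closure_mono)
  finally show ?L .
qed

text \<open>A pointwise substitute for the components of diameter at least \<open>1 / Suc k\<close>.
  For compact \<open>C\<close> it meets each of these, but need not contain them: a point in the
  middle of a component may have no partner far enough away.\<close>

definition big :: "nat \<Rightarrow> 'a::metric_space set \<Rightarrow> 'a set" where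
  "big k C = {x. \<exists>y. connected_component C x y \<and> dist x y \<ge> 1 / Suc k}"

text \<open>The cut \<open>c\<close> leaves at most one component with big points on its first side.
  Avoiding \<open>snd c\<close> is used in place of lying in \<open>fst c\<close>, because it is a
  closed condition; for points of \<open>C\<close> and a cut covering \<open>C\<close> the two
  agree.\<close>

definition good :: "nat \<Rightarrow> 'a::metric_space set \<times> 'a set \<Rightarrow> 'a set \<Rightarrow> bool" where
  "good k c C \<longleftrightarrow> C \<subseteq> fst c \<union> snd c \<and>
     (\<forall>x\<in>big k C - snd c. \<forall>y\<in>big k C - snd c. connected_component C x y)"

lemma big_subset: "big k C \<subseteq> C"
  unfolding big_def using connected_component_in by blast


lemma nondegenerate_big:
  assumes "connected_component C x y" "x \<noteq> y"
  obtains k where "x \<in> big k C"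
proof -
  obtain k where "1 / Suc k < dist x y"
    using nat_approx_posE[of "dist x y"] assms(2) by auto
  then have "x \<in> big k C" using assms(1) unfolding big_def by (intro CollectI exI[of _ y] conjI) simp_all
  then show thesis by (rule that)
qed

lemma big_component_diameter:
  assumes "compact C" "x \<in> big k C"
  shows "connected_component_set C x \<in> {D \<in> components C. diameter D \<ge> 1 / Suc k}"
proof -
  have D: "connected_component_set C x \<in> components C"
    using assms(2) big_subset by (force simp: components_def)
  obtain y where y: "connected_component C x y" "dist x y \<ge> 1 / Suc k"
    using assms(2) unfolding big_def by blast
  have "bounded (connected_component_set C x)"
    using compact_imp_bounded[OF compact_component[OF assms(1) D]] .
  then have "dist x y \<le> diameter (connected_component_set C x)"
    using y(1) connected_component_refl[of x C] connected_component_in[OF y(1)]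
    by (intro diameter_bounded_bound) auto
  then show ?thesis using D y(2) by auto
qed

text \<open>By finiteness the remaining large components form a closed set, so a cut around the
  component of \<open>x\<close> can avoid them all. A big point on the first side has a large
  component meeting \<open>V\<close>, which can only be that of \<open>x\<close>.\<close>

lemma big_isolated:
  fixes C :: "'a::{metric_space, second_countable_topology} set"
  assumes C: "compact C" and fin: "finite {D \<in> components C. diameter D \<ge> 1 / Suc k}" (is "finite ?F")
    and x: "x \<in> big k C"
  obtains c where "c \<in> cuts" "good k c C" "x \<in> fst c"
proof -
  define D where "D = connected_component_set C x"
  have xC: "x \<in> C" using x big_subset by blast
  have op: "open (- \<Union>(?F - {D}))"
    using fin closed_components[OF compact_imp_closed[OF C]] by (intro open_Compl closed_Union) auto
  have sub: "D \<subseteq> - \<Union>(?F - {D})"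
  proof -
    have "D \<in> components C" using xC unfolding D_def components_def by blast
    then have "D \<inter> E = {}" if "E \<in> ?F - {D}" for E
      using that components_nonoverlap[of D C E] by blast
    then show ?thesis by blast
  qed
  obtain V W where VW: "(V, W) \<in> cuts" "C \<subseteq> V \<union> W" "D \<subseteq> V" "V \<subseteq> - \<Union>(?F - {D})"
    by (rule component_cut[OF C xC sub[unfolded D_def] op[unfolded D_def]]) (simp add: D_def)
  have in_D: "y \<in> D" if y: "y \<in> big k C - W" for y
  proof -
    have yC: "y \<in> C" using y big_subset by blast
    then have "y \<in> V" using y VW(2) by blast
    moreover have "y \<in> connected_component_set C y" using yC by simp
    moreover have "connected_component_set C y \<in> ?F" using big_component_diameter[OF C] y by blast
    ultimately have "connected_component_set C y = D" using VW(4) by blast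
    then show ?thesis using \<open>y \<in> connected_component_set C y\<close> by blast
  qed
  have "good k (V, W) C"
    unfolding good_def fst_conv snd_conv
  proof (intro conjI ballI)
    fix y z assume "y \<in> big k C - W" "z \<in> big k C - W"
    then have "connected_component C x y" "connected_component C x z" using in_D unfolding D_def by blast+
    then show "connected_component C y z"
      using connected_component_sym connected_component_trans by metis
  qed (use VW in blast)
  moreover have "x \<in> V" using VW(3) xC unfolding D_def by auto
  ultimately show thesis using that VW(1) by force
qed

text \<open>A good cut accounts for at most one large component, so a finite cover by good cuts
  bounds their number; conversely each of finitely many large components with a big point has a good
  cut around it. The quantifier over \<open>I\<close> ranges over a countable set.\<close>

lemma tame_iff:
  fixes C :: "'a::{metric_space, second_countable_topology} set"
  assumes C: "compact C"
  shows "(\<forall>\<epsilon>>0. finite {D \<in> components C. diameter D \<ge> \<epsilon>}) \<longleftrightarrow>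
    (\<forall>k. \<exists>I\<in>{I. finite I \<and> I \<subseteq> cuts}. (\<forall>c\<in>I. good k c C) \<and> big k C \<subseteq> \<Union>(fst ` I))"
    (is "?L \<longleftrightarrow> ?R")
proof
  assume L: ?L
  show ?R
  proof
    fix k
    let ?F = "{D \<in> components C. diameter D \<ge> 1 / Suc k}"
    have fin: "finite ?F" using L by (metis of_nat_0_less_iff zero_less_Suc zero_less_divide_1_iff)
    define B where "B = connected_component_set C ` big k C"
    have "finite B"
      using fin big_component_diameter[OF C] by (rule_tac finite_subset[of _ ?F]) (auto simp: B_def)
    have "\<exists>c. c \<in> cuts \<and> good k c C \<and> D \<subseteq> fst c" if D: "D \<in> B" for D
    proof -
      obtain x where x: "x \<in> big k C" "D = connected_component_set C x" using D unfolding B_def by blast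
      obtain c where c: "c \<in> cuts" "good k c C" "x \<in> fst c" using big_isolated[OF C fin x(1)] by blast
      have "D \<subseteq> fst c"
        unfolding x(2) using c cut_connected_component[of "fst c" "snd c" C x] unfolding good_def by auto
      then show ?thesis using c by blast
    qed
    then obtain f where f: "\<And>D. D \<in> B \<Longrightarrow> f D \<in> cuts \<and> good k (f D) C \<and> D \<subseteq> fst (f D)" by metis
    have "big k C \<subseteq> \<Union>(fst ` f ` B)"
    proof
      fix x assume x: "x \<in> big k C"
      then have "x \<in> connected_component_set C x" using big_subset[of k C] by auto
      moreover have "connected_component_set C x \<in> B" using x unfolding B_def by blast
      ultimately show "x \<in> \<Union>(fst ` f ` B)" using f by blast
    qed
    then show "\<exists>I\<in>{I. finite I \<and> I \<subseteq> cuts}. (\<forall>c\<in>I. good k c C) \<and> big k C \<subseteq> \<Union>(fst ` I)"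
      using f \<open>finite B\<close> by (intro bexI[of _ "f ` B"]) auto
  qed
next
  assume R: ?R
  show ?L
  proof (intro allI impI)
    fix \<epsilon> :: real assume "\<epsilon> > 0"
    then obtain k where k: "1 / Suc k < \<epsilon>" using nat_approx_posE by blast
    obtain I where I: "finite I" "I \<subseteq> cuts" "\<And>c. c \<in> I \<Longrightarrow> good k c C" "big k C \<subseteq> \<Union>(fst ` I)"
      using R[rule_format, of k] by (elim bexE) auto
    define K where "K c = {D \<in> components C. \<exists>x\<in>D. x \<in> big k C - snd c}" for c :: "'a set \<times> 'a set"
    have "finite (K c)" if c: "c \<in> I" for c
    proof -
      have "D = E" if "D \<in> K c" "E \<in> K c" for D E
      proof -
        obtain x y where xy: "x \<in> D" "y \<in> E" "x \<in> big k C - snd c" "y \<in> big k C - snd c"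
          "D \<in> components C" "E \<in> components C"
          using \<open>D \<in> K c\<close> \<open>E \<in> K c\<close> unfolding K_def by blast
        have "connected_component C x y" using I(3)[OF c] xy(3,4) unfolding good_def by blast
        moreover have "D = connected_component_set C x" "E = connected_component_set C y"
          using xy component_eq by blast+
        ultimately show "D = E" using connected_component_eq by (metis mem_Collect_eq)
      qed
      then have "\<exists>D. K c \<subseteq> {D}" by blast
      then show ?thesis using finite_subset by blast
    qed
    moreover have "{D \<in> components C. diameter D \<ge> \<epsilon>} \<subseteq> (\<Union>c\<in>I. K c)"
    proof safe
      fix D assume D: "D \<in> components C" "diameter D \<ge> \<epsilon>"
      \<comment> \<open>The diameter of a compact component is attained, which gives it a big
        point.\<close>
      obtain x y where xy: "x \<in> D" "y \<in> D" "dist x y = diameter D"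
        using diameter_compact_attained[OF compact_component[OF C D(1)]] in_components_nonempty[OF D(1)] by blast
      have "connected_component C x y"
        using connected_componentI[OF in_components_connected[OF D(1)] in_components_subset[OF D(1)] xy(1,2)] .
      then have xb: "x \<in> big k C" using xy(3) D(2) k unfolding big_def by force
      then obtain c where c: "c \<in> I" "x \<in> fst c" using I(4) by blast
      then have "x \<notin> snd c" using I(2) cutsD(3)[of "fst c" "snd c"] by auto
      then show "D \<in> (\<Union>c\<in>I. K c)" using c xb xy(1) D(1) unfolding K_def by blast
    qed
    ultimately show "finite {D \<in> components C. diameter D \<ge> \<epsilon>}"
      using I(1) finite_subset by blast
  qed
qed

text \<open>Brouwer's theorem turns the absence of nondegenerate components into a homeomorphism;
  conversely, a connected set has a single value in each discrete coordinate of the Cantor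
  space.\<close>

lemma not_cantor_space_iff:
  fixes C :: "'a::{metric_space, second_countable_topology} set"
  assumes C: "compact C" "C \<noteq> {}" "\<nexists>x. x isolated_in C"
  shows "\<not> C homeomorphic cantor_space \<longleftrightarrow> (\<exists>k. big k C \<noteq> {})"
proof
  assume "\<not> C homeomorphic cantor_space"
  then obtain x y where "connected_component C x y" "x \<noteq> y"
    using Brouwer_cantor_space[OF C] by blast
  then show "\<exists>k. big k C \<noteq> {}" using nondegenerate_big[of C x y] by blast
next
  assume "\<exists>k. big k C \<noteq> {}"
  then obtain k x y where xy: "connected_component C x y" "dist x y \<ge> 1 / Suc k"
    unfolding big_def by blast
  then have "x \<noteq> y" by (auto simp: not_le)
  show "\<not> C homeomorphic cantor_space"
  proof
    assume "C homeomorphic cantor_space"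
    then obtain \<phi> \<psi> where \<phi>: "homeomorphism C (UNIV :: (nat \<Rightarrow> bool) set) \<phi> \<psi>"
      unfolding homeomorphic_def cantor_space_def by blast
    have "\<phi> x \<noteq> \<phi> y"
      using homeomorphism_apply1[OF \<phi>] connected_component_in[OF xy(1)] \<open>x \<noteq> y\<close> by metis
    then obtain n where n: "\<phi> x n \<noteq> \<phi> y n" by blast
    have "continuous_on C (\<lambda>z. \<phi> z n)"
      using continuous_on_product_then_coordinatewise[OF homeomorphism_cont1[OF \<phi>]] .
    then have "connected_component UNIV (\<phi> x n) (\<phi> y n)"
      using connected_component_image[OF xy(1), of "\<lambda>z. \<phi> z n" UNIV] by simp
    then obtain T where T: "connected T" "\<phi> x n \<in> T" "\<phi> y n \<in> T"
      unfolding connected_component_def by blast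
    then show False
      using connectedD[OF T(1), of "{True}" "{False}"] n by (cases "\<phi> x n") (auto simp: open_discrete)
  qed
qed

section \<open>Minimality and the iterates of a component\<close>

lemma continuous_on_iterate:
  assumes "continuous_on C h" "h ` C \<subseteq> C"
  shows "continuous_on C (h ^^ n)"
proof (induction n)
  case (Suc n)
  have "(h ^^ n) ` C \<subseteq> C" using iterate_in[OF assms(2)] by blast
  then have "continuous_on C (h \<circ> (h ^^ n))"
    using continuous_on_compose[OF Suc continuous_on_subset[OF assms(1)]] by blast
  then show ?case by simp
qed (simp add: id_def)

text \<open>Compactness makes the hitting times of \<open>U\<close> uniformly bounded. With a bound
  \<open>N\<close>, failure is the existence of a finite orbit segment that avoids \<open>U\<close>,
  which is a closed condition.\<close>

lemma minimal_iff:
  fixes C :: "'a::{metric_space, second_countable_topology} set"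
  assumes C: "compact C" "continuous_on C h" "h ` C \<subseteq> C"
  shows "minimal_system C h \<longleftrightarrow>
    (\<forall>U\<in>ubase. C \<inter> U \<noteq> {} \<longrightarrow> (\<exists>N. \<forall>x\<in>C. \<exists>i\<le>N. (h ^^ i) x \<in> U))"
    (is "_ \<longleftrightarrow> ?R")
proof
  assume m: "minimal_system C h"
  show ?R
  proof (intro ballI impI)
    fix U assume U: "U \<in> ubase" "C \<inter> U \<noteq> {}"
    have cont: "continuous_on C (h ^^ i)" for i
      using continuous_on_iterate[OF C(2,3)] .
    have "\<exists>T. open T \<and> C \<inter> (h ^^ i) -` U = C \<inter> T" for i
      using continuous_openin_preimage_gen[OF cont open_ubase[OF U(1)]] unfolding openin_open by blast
    then obtain T where T: "\<And>i. open (T i)" "\<And>i. C \<inter> (h ^^ i) -` U = C \<inter> T i" by metis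
    have "C \<subseteq> (\<Union>i\<in>UNIV. T i)"
    proof
      fix x assume x: "x \<in> C"
      have "U \<inter> closure (range (\<lambda>n. (h ^^ n) x)) \<noteq> {}"
        using minimal_systemD(5)[OF m x] U(2) by blast
      then obtain i where "(h ^^ i) x \<in> U"
        using open_Int_closure_eq_empty[OF open_ubase[OF U(1)]] by blast
      then have "x \<in> C \<inter> T i" using x unfolding T(2)[symmetric] by simp
      then show "x \<in> (\<Union>i\<in>UNIV. T i)" by blast
    qed
    then obtain I where I: "finite I" "C \<subseteq> (\<Union>i\<in>I. T i)"
      using compactE_image[OF C(1), of UNIV T] T(1) by metis
    \<comment> \<open>\<open>0\<close> is inserted so that the maximum is taken over a set that is
      plainly nonempty.\<close>
    have "\<forall>x\<in>C. \<exists>i\<le>Max (insert 0 I). (h ^^ i) x \<in> U"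
    proof
      fix x assume "x \<in> C"
      then obtain i where "i \<in> I" "x \<in> C \<inter> T i" using I(2) by blast
      then have "(h ^^ i) x \<in> U" unfolding T(2)[symmetric] by simp
      then show "\<exists>i\<le>Max (insert 0 I). (h ^^ i) x \<in> U"
        using \<open>i \<in> I\<close> I(1) by (intro exI[of _ i]) simp
    qed
    then show "\<exists>N. \<forall>x\<in>C. \<exists>i\<le>N. (h ^^ i) x \<in> U" ..
  qed
next
  assume R: ?R
  have "y \<in> closure (range (\<lambda>n. (h ^^ n) x))" if x: "x \<in> C" and y: "y \<in> C" for x y
  proof (rule ccontr)
    assume "y \<notin> closure (range (\<lambda>n. (h ^^ n) x))"
    then obtain U where U: "U \<in> ubase" "y \<in> U" "U \<subseteq> - closure (range (\<lambda>n. (h ^^ n) x))"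
      using ubase_point[of "- closure (range (\<lambda>n. (h ^^ n) x))" y] by auto
    then have "C \<inter> U \<noteq> {}" using y by blast
    then obtain i where "(h ^^ i) x \<in> U" using R U(1) x by blast
    then show False using U(3) closure_subset[of "range (\<lambda>n. (h ^^ n) x)"] by auto
  qed
  then show "minimal_system C h" unfolding minimal_system_def using C by blast
qed

text \<open>The limit is a fixed point, and its orbit must be dense. This separates genuine orbits
  from the constant sequences used as fillers.\<close>

lemma minimal_orbit_convergent:
  fixes C :: "'a::metric_space set"
  assumes m: "minimal_system C h" and x: "x \<in> C" and l: "(\<lambda>n. (h ^^ n) x) \<longlonglongrightarrow> l"
  shows "C \<subseteq> {l}"
proof -
  note mD = minimal_systemD[OF m]
  have lC: "l \<in> C" using closed_sequentially[OF compact_imp_closed[OF mD(1)] _ l] mD(4)[OF x] by blast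
  have "(\<lambda>n. h ((h ^^ n) x)) \<longlonglongrightarrow> h l"
    using mD(4)[OF x] lC by (intro continuous_on_tendsto_compose[OF mD(2) l]) auto
  moreover have "(\<lambda>n. h ((h ^^ n) x)) \<longlonglongrightarrow> l" using LIMSEQ_Suc[OF l] by simp
  ultimately have "h l = l" using LIMSEQ_unique by blast
  then show ?thesis using minimal_closed_invariant[OF m, of "{l}" l] lC by simp
qed

text \<open>A nondegenerate component \<open>D\<close> is never periodic: otherwise \<open>C\<close> would be a finite union of
  iterates of \<open>D\<close>, without degenerate components. So the iterates of \<open>D\<close> form a null sequence.\<close>

lemma nondegenerate_component_wandering:
  fixes C :: "'a::metric_space set"
  assumes c: "cantoroid C" and inv: "homeomorphism C C h g" and m: "minimal_system C h"
    and xy: "connected_component C x y" "x \<noteq> y" and ij: "i < j"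
  shows "\<not> connected_component C ((h ^^ i) x) ((h ^^ j) x)"
proof
  assume conn: "connected_component C ((h ^^ i) x) ((h ^^ j) x)"
  note mD = minimal_systemD[OF m]
  have xC: "x \<in> C" "y \<in> C" using connected_component_in[OF xy(1)] by auto
  have gC: "g ` C \<subseteq> C" "continuous_on C g"
    using homeomorphism_image2[OF inv] homeomorphism_cont2[OF inv] by auto
  define p where "p = j - i"
  have p: "p > 0" using ij by (simp add: p_def)
  \<comment> \<open>\<open>g\<close> undoes \<open>h\<close>, so connectedness passes backwards
    along orbits and the recurrence can be moved from time \<open>i\<close> to time
    \<open>0\<close>.\<close>
  have pull: "connected_component C u v"
    if "u \<in> C" "v \<in> C" "connected_component C ((h ^^ n) u) ((h ^^ n) v)" for u v n
    using that
  proof (induction n)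
    case (Suc n)
    have "connected_component C (g ((h ^^ Suc n) u)) (g ((h ^^ Suc n) v))"
      using connected_component_image[OF Suc.prems(3) gC(2,1)] .
    then show ?case
      using Suc homeomorphism_apply1[OF inv] mD(4) by simp
  qed simp
  have fwd: "connected_component C ((h ^^ n) u) ((h ^^ n) v)" if "connected_component C u v" for u v n
    using that connected_component_image[OF _ mD(2,3)] by (induction n) auto
  have "(h ^^ j) x = (h ^^ i) ((h ^^ p) x)"
    using ij by (simp add: p_def funpow_add[symmetric, unfolded o_def fun_eq_iff, rule_format])
  then have per: "connected_component C x ((h ^^ p) x)"
    using pull[OF xC(1) mD(4)[OF xC(1)], of i p] conn by simp
  define D where "D = connected_component_set C x"
  have D: "D \<subseteq> C" "connected D" "compact D" "x \<in> D" "y \<in> D"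
    using connected_component_subset[of C x] xC xy(1)
      compact_component[OF mD(1), of D] by (auto simp: D_def components_def)
  have hpD: "(h ^^ p) ` D \<subseteq> D"
    using per fwd[of x _ p] connected_component_trans[of C x "(h ^^ p) x"] unfolding D_def by blast
  have cont: "continuous_on C (h ^^ n)" for n
    using continuous_on_iterate[OF mD(2,3)] .
  define A where "A = (\<Union>n<p. (h ^^ n) ` D)"
  have "closed A"
    unfolding A_def using compact_continuous_image[OF continuous_on_subset[OF cont D(1)] D(3)]
    by (intro closed_UN) (auto intro: compact_imp_closed)
  moreover have "x \<in> A" using p D(4) unfolding A_def by (auto intro!: bexI[of _ 0])
  moreover have "h ` (A \<inter> C) \<subseteq> A"
  proof
    fix w assume "w \<in> h ` (A \<inter> C)"
    then obtain n z where n: "n < p" "z \<in> D" "w = h ((h ^^ n) z)" unfolding A_def by blast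
    show "w \<in> A"
    proof (cases "Suc n < p")
      case True
      then show ?thesis using n unfolding A_def by (intro UN_I[of "Suc n"]) auto
    next
      case False
      then have "w = (h ^^ p) z" using n by (metis Suc_lessI funpow.simps(2) comp_apply)
      then have "w \<in> D" using hpD n(2) by blast
      then show ?thesis using p unfolding A_def by (intro UN_I[of 0]) auto
    qed
  qed
  ultimately have CA: "C \<subseteq> A" using minimal_closed_invariant[OF m _ _ xC(1)] by blast
  have "\<Union>{D \<in> components C. is_singleton D} \<noteq> {}"
  proof
    assume "\<Union>{D \<in> components C. is_singleton D} = {}"
    then have "C \<subseteq> {}" using c closure_empty unfolding cantoroid_def by metis
    then show False using xC by blast
  qed
  then obtain z where z: "z \<in> C" "\<And>w. connected_component C z w \<Longrightarrow> w = z"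
    unfolding degenerate_components by blast
  \<comment> \<open>A point \<open>z\<close> with degenerate component lies in some iterate of
    \<open>D\<close>. That iterate is connected, so it collapses to \<open>z\<close>, against the
    injectivity of \<open>h\<close>.\<close>
  then obtain n w where n: "w \<in> D" "z = (h ^^ n) w" using CA unfolding A_def by blast
  have "connected_component C w x" "connected_component C w y"
    using n(1) D connected_componentI by metis+
  then have "(h ^^ n) x = z" "(h ^^ n) y = z" using z(2) fwd n(2) by blast+
  then have "connected_component C ((h ^^ n) x) ((h ^^ n) y)" "(h ^^ n) x = (h ^^ n) y"
    using z(1) by auto
  moreover have "u = v" if "u \<in> C" "v \<in> C" "(h ^^ n) u = (h ^^ n) v" for u v n
    using that
  proof (induction n)
    case (Suc n)
    then show ?case using homeomorphism_apply1[OF inv] mD(4) by (metis comp_apply funpow.simps(2))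
  qed simp
  ultimately show False using xC xy(2) by blast
qed

text \<open>If some \<open>y n\<close> differs from \<open>x\<close>, the iterates of the component
  of \<open>x\<close> are pairwise distinct components, and tameness leaves only finitely many of
  diameter at least \<open>e\<close>. The partner \<open>y n\<close> may change with
  \<open>n\<close>, since the reduction restarts from a new point of the component at each
  time.\<close>

lemma component_orbit_null:
  fixes C :: "'a::metric_space set"
  assumes t: "tame_cantoroid C" and inv: "invertible_system C h" and m: "minimal_system C h"
    and xy: "\<And>n. connected_component C x (y n)"
  shows "(\<lambda>n. dist ((h ^^ n) x) ((h ^^ n) (y n))) \<longlonglongrightarrow> 0"
proof (cases "\<forall>n. x = y n")
  case False
  then obtain y' where xy': "connected_component C x y'" "x \<noteq> y'" using xy by blast
  note mD = minimal_systemD[OF m]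
  obtain g where g: "homeomorphism C C h g" using inv unfolding invertible_system_def by blast
  have c: "cantoroid C" using t unfolding tame_cantoroid_def by blast
  have fwd: "connected_component C ((h ^^ n) x) ((h ^^ n) (y n))" for n
  proof -
    have "connected_component C ((h ^^ i) x) ((h ^^ i) (y n))" for i
      using xy[of n] connected_component_image[OF _ mD(2,3)] by (induction i) auto
    then show ?thesis .
  qed
  define D where "D n = connected_component_set C ((h ^^ n) x)" for n
  have xC: "x \<in> C" using connected_component_in[OF xy'(1)] by auto
  have D: "D n \<in> components C" for n using mD(4)[OF xC] by (auto simp: D_def components_def)
  have inj: "inj D"
  proof (rule injI)
    fix i j assume "D i = D j"
    then have "connected_component C ((h ^^ i) x) ((h ^^ j) x)" "connected_component C ((h ^^ j) x) ((h ^^ i) x)"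
      using mD(4)[OF xC] connected_component_refl unfolding D_def by blast+
    then show "i = j"
      using nondegenerate_component_wandering[OF c g m xy'] by (meson linorder_neqE_nat)
  qed
  show ?thesis
  proof (rule LIMSEQ_I)
    fix e :: real assume "e > 0"
    then have "finite {E \<in> components C. diameter E \<ge> e}" using t unfolding tame_cantoroid_def by blast
    then have "finite (D -` {E \<in> components C. diameter E \<ge> e})" using inj by (rule finite_vimageI)
    then obtain N where N: "\<And>n. D n \<in> {E \<in> components C. diameter E \<ge> e} \<Longrightarrow> n < N"
      unfolding finite_nat_set_iff_bounded by auto
    have "dist ((h ^^ n) x) ((h ^^ n) (y n)) < e" if "n \<ge> N" for n
    proof -
      have "\<not> e \<le> diameter (D n)" using N[of n] that D by auto
      then have "diameter (D n) < e" by simp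
      moreover have "dist ((h ^^ n) x) ((h ^^ n) (y n)) \<le> diameter (D n)"
        using fwd[of n] mD(4)[OF xC, of n] compact_imp_bounded[OF compact_component[OF mD(1) D[of n]]]
        by (intro diameter_bounded_bound) (auto simp: D_def)
      ultimately show ?thesis by simp
    qed
    then show "\<exists>N. \<forall>n\<ge>N. norm (dist ((h ^^ n) x) ((h ^^ n) (y n)) - 0) < e" by auto
  qed
qed simp

section \<open>Closed and Borel predicates of codes\<close>

lemma compact_seqs:
  assumes "compact (A :: 'a::topological_space set)"
  shows "compact (seqs A)"
proof -
  have "compactin (product_topology (\<lambda>_::nat. euclidean) UNIV) (PiE UNIV (\<lambda>_. A))"
    using assms by (simp add: compactin_PiE)
  moreover have "PiE UNIV (\<lambda>_::nat. A) = seqs A" by (auto simp: seqs_def)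
  ultimately show ?thesis by (simp add: euclidean_product_topology)
qed

lemma hilbert_cube_eq_seqs: "hilbert_cube = seqs {0..1}"
  unfolding hilbert_cube_def seqs_def by simp

lemma compact_hilbert_cube: "compact hilbert_cube"
  unfolding hilbert_cube_eq_seqs by (intro compact_seqs) simp

lemma hilbert_cube_nonempty: "(\<lambda>_. 0) \<in> hilbert_cube"
  by (simp add: hilbert_cube_def)

lemma seqsI: "(\<And>n. z n \<in> A) \<Longrightarrow> z \<in> seqs A"
  and seqsD: "z \<in> seqs A \<Longrightarrow> z n \<in> A"
  unfolding seqs_def by auto

lemma topspace_vietoris: "topspace (vietoris Z) = compacts Z"
  unfolding vietoris_def topology_generated_by_topspace by (auto intro!: exI[of _ UNIV])

lemma openin_vietoris:
  assumes "open U"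
  shows "openin (vietoris Z) {K \<in> compacts Z. K \<subseteq> U}"
    and "openin (vietoris Z) {K \<in> compacts Z. K \<inter> U \<noteq> {}}"
  unfolding vietoris_def using assms by (intro topology_generated_by_Basis; blast)+

lemma topspace_code_space:
  "topspace code_space = compacts hilbert_cube \<times> compacts (hilbert_cube \<times> hilbert_cube)"
  unfolding code_space_def by (simp add: topspace_vietoris)

lemma code_spaceD:
  assumes "c \<in> topspace code_space"
  shows "compact (fst c)" "fst c \<noteq> {}" "fst c \<subseteq> hilbert_cube"
    "compact (snd c)" "snd c \<noteq> {}" "snd c \<subseteq> hilbert_cube \<times> hilbert_cube"
  using assms unfolding topspace_code_space compacts_def by auto

lemma openin_code_space:
  fixes U :: "(nat \<Rightarrow> real) set" and W :: "((nat \<Rightarrow> real) \<times> (nat \<Rightarrow> real)) set"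
  assumes "open U" "open W"
  shows "openin code_space {c \<in> topspace code_space. fst c \<subseteq> U}"
    and "openin code_space {c \<in> topspace code_space. fst c \<inter> U \<noteq> {}}"
    and "openin code_space {c \<in> topspace code_space. snd c \<subseteq> W}"
proof -
  have f: "continuous_map code_space (vietoris hilbert_cube) fst"
    and s: "continuous_map code_space (vietoris (hilbert_cube \<times> hilbert_cube)) snd"
    unfolding code_space_def by (rule continuous_map_fst continuous_map_snd)+
  have "{c \<in> topspace code_space. fst c \<subseteq> U}
      = {c \<in> topspace code_space. fst c \<in> {K \<in> compacts hilbert_cube. K \<subseteq> U}}"
    "{c \<in> topspace code_space. fst c \<inter> U \<noteq> {}}
      = {c \<in> topspace code_space. fst c \<in> {K \<in> compacts hilbert_cube. K \<inter> U \<noteq> {}}}"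
    "{c \<in> topspace code_space. snd c \<subseteq> W}
      = {c \<in> topspace code_space. snd c \<in> {K \<in> compacts (hilbert_cube \<times> hilbert_cube). K \<subseteq> W}}"
    by (auto simp: topspace_code_space)
  then show "openin code_space {c \<in> topspace code_space. fst c \<subseteq> U}"
    "openin code_space {c \<in> topspace code_space. fst c \<inter> U \<noteq> {}}"
    "openin code_space {c \<in> topspace code_space. snd c \<subseteq> W}"
    using openin_continuous_map_preimage[OF f openin_vietoris(1)[OF assms(1)]]
      openin_continuous_map_preimage[OF f openin_vietoris(2)[OF assms(1)]]
      openin_continuous_map_preimage[OF s openin_vietoris(1)[OF assms(2)]] by presburger+
qed

text \<open>Witnesses range over the compact space of sequences in \<open>Q\<close>, so that a closed predicate may
  speak about any number of points of \<open>Q\<close> and existential quantification preserves closedness.\<close>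

definition wit_space :: "(system_code \<times> (nat \<Rightarrow> nat \<Rightarrow> real)) topology" where
  "wit_space = prod_topology code_space (top_of_set (seqs hilbert_cube))"

definition openp :: "(system_code \<Rightarrow> (nat \<Rightarrow> nat \<Rightarrow> real) \<Rightarrow> bool) \<Rightarrow> bool" where
  "openp P \<longleftrightarrow> openin wit_space {p \<in> topspace wit_space. P (fst p) (snd p)}"

abbreviation closedp :: "(system_code \<Rightarrow> (nat \<Rightarrow> nat \<Rightarrow> real) \<Rightarrow> bool) \<Rightarrow> bool" where
  "closedp P \<equiv> openp (\<lambda>c z. \<not> P c z)"

abbreviation borelp :: "(system_code \<Rightarrow> bool) \<Rightarrow> bool" where
  "borelp R \<equiv> Measurable.pred (borel_of code_space) R"

section \<open>Open and closed predicates\<close>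

lemma topspace_wit_space: "topspace wit_space = topspace code_space \<times> seqs hilbert_cube"
  unfolding wit_space_def by simp

lemma openp_cong:
  assumes "openp P" "\<And>c z. c \<in> topspace code_space \<Longrightarrow> z \<in> seqs hilbert_cube \<Longrightarrow> P c z \<longleftrightarrow> R c z"
  shows "openp R"
proof -
  have "{p \<in> topspace wit_space. P (fst p) (snd p)} = {p \<in> topspace wit_space. R (fst p) (snd p)}"
    using assms(2) by (auto simp: topspace_wit_space)
  then show ?thesis using assms(1) unfolding openp_def by simp
qed

lemma openp_ex:
  assumes "\<And>i. openp (P i)"
  shows "openp (\<lambda>c z. \<exists>i. P i c z)"
proof -
  have "openin wit_space (\<Union>i. {p \<in> topspace wit_space. P i (fst p) (snd p)})"
    using assms unfolding openp_def by (intro openin_Union) auto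
  moreover have "(\<Union>i. {p \<in> topspace wit_space. P i (fst p) (snd p)})
      = {p \<in> topspace wit_space. \<exists>i. P i (fst p) (snd p)}" by auto
  ultimately show ?thesis unfolding openp_def by simp
qed

lemma openp_conj:
  assumes "openp P" "openp R"
  shows "openp (\<lambda>c z. P c z \<and> R c z)"
  using openin_Int[OF assms[unfolded openp_def]] unfolding openp_def Collect_conj_eq[symmetric]
  by (simp add: conj_ac)

lemma openp_const: "openp (\<lambda>c z. b)"
  unfolding openp_def by (cases b) auto

text \<open>A side condition that involves neither code nor witness may be assumed. It allows unions
  over all sets \<open>U\<close>, with their openness as part of the predicate.\<close>

lemma openp_guard: "(b \<Longrightarrow> openp P) \<Longrightarrow> openp (\<lambda>c z. b \<and> P c z)"
  using openp_const[of False] by (cases b) simp_all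

lemma openp_disj:
  assumes "openp P" "openp R"
  shows "openp (\<lambda>c z. P c z \<or> R c z)"
  using openin_Un[OF assms[unfolded openp_def]] unfolding openp_def Collect_disj_eq[symmetric]
  by (simp add: conj_disj_distribL)

lemma openp_code:
  assumes "openin code_space {c \<in> topspace code_space. P c}"
  shows "openp (\<lambda>c z. P c)"
proof -
  have "openin wit_space {p \<in> topspace wit_space. fst p \<in> {c \<in> topspace code_space. P c}}"
    using openin_continuous_map_preimage[OF continuous_map_fst assms] unfolding wit_space_def .
  moreover have "{p \<in> topspace wit_space. fst p \<in> {c \<in> topspace code_space. P c}}
      = {p \<in> topspace wit_space. P (fst p)}" by (auto simp: topspace_wit_space)
  ultimately show ?thesis unfolding openp_def by simp
qed

lemma openp_wit:
  assumes "open {z. P z}"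
  shows "openp (\<lambda>c z. P z)"
proof -
  have "openin (top_of_set (seqs hilbert_cube)) (seqs hilbert_cube \<inter> {z. P z})"
    using assms by (rule openin_open_Int)
  then have "openin wit_space {p \<in> topspace wit_space. snd p \<in> seqs hilbert_cube \<inter> {z. P z}}"
    using openin_continuous_map_preimage[OF continuous_map_snd] unfolding wit_space_def by blast
  moreover have "{p \<in> topspace wit_space. snd p \<in> seqs hilbert_cube \<inter> {z. P z}}
      = {p \<in> topspace wit_space. P (snd p)}" by (auto simp: topspace_wit_space)
  ultimately show ?thesis unfolding openp_def by simp
qed

lemma continuous_coordinate: "continuous_on UNIV (\<lambda>z::nat \<Rightarrow> 'a::topological_space. z i)"
  by (rule continuous_on_product_coordinates)

lemma closedp_conj: "closedp P \<Longrightarrow> closedp R \<Longrightarrow> closedp (\<lambda>c z. P c z \<and> R c z)"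
  using openp_disj[of "\<lambda>c z. \<not> P c z" "\<lambda>c z. \<not> R c z"] by simp

lemma closedp_all: "(\<And>i. closedp (P i)) \<Longrightarrow> closedp (\<lambda>c z. \<forall>i. P i c z)"
  using openp_ex[of "\<lambda>i c z. \<not> P i c z"] by simp

lemma closedp_imp: "(b \<Longrightarrow> closedp P) \<Longrightarrow> closedp (\<lambda>c z. b \<longrightarrow> P c z)"
  using openp_const[of False] by (cases b) simp_all

lemma closedp_wit: "closed {z. P z} \<Longrightarrow> closedp (\<lambda>c z. P z)"
  by (rule openp_wit) (simp add: closed_def Collect_neg_eq)

lemma closedp_dist_ge: "closedp (\<lambda>c z. r \<le> dist (z i) (z j))"
  by (intro closedp_wit closed_Collect_le continuous_intros continuous_coordinate)

lemma closedp_dist_le: "closedp (\<lambda>c z. dist (z i) q \<le> r)"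
  by (intro closedp_wit closed_Collect_le continuous_intros continuous_coordinate)

lemma closedp_not_in:
  assumes "open U"
  shows "closedp (\<lambda>c z. z i \<notin> U)"
proof (rule closedp_wit)
  have "open ((\<lambda>z::nat \<Rightarrow> nat \<Rightarrow> real. z i) -` U)"
    using assms continuous_coordinate by (rule open_vimage)
  then show "closed {z. z i \<notin> U}" by (simp add: closed_def vimage_def Collect_neg_eq[symmetric])
qed

lemma openp_in:
  assumes "open U" "continuous_on UNIV g"
  shows "openp (\<lambda>c z. g z \<in> U)"
  using open_vimage[OF assms] by (intro openp_wit) (simp add: vimage_def)

text \<open>Regularity splits non-membership into a condition on \<open>K\<close> and a condition on
  \<open>x\<close>, each of them open. So membership is closed in both arguments jointly, although
  \<open>K\<close> varies.\<close>

lemma not_in_compact_iff: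
  fixes K :: "'a::t3_space set"
  assumes "compact K"
  shows "(\<exists>U V. (open U \<and> open V \<and> U \<inter> V = {}) \<and> K \<subseteq> U \<and> x \<in> V) \<longleftrightarrow> x \<notin> K"
proof
  assume "x \<notin> K"
  then show "\<exists>U V. (open U \<and> open V \<and> U \<inter> V = {}) \<and> K \<subseteq> U \<and> x \<in> V"
    using t3_space[OF compact_imp_closed[OF assms], of x] by (metis inf_commute)
qed blast

lemma closedp_in_fst: "closedp (\<lambda>c z. z i \<in> fst c)"
proof (rule openp_cong)
  show "openp (\<lambda>c z. \<exists>U V. (open U \<and> open V \<and> U \<inter> V = {}) \<and> fst c \<subseteq> U \<and> z i \<in> V)"
  proof (intro openp_ex)
    fix U V :: "(nat \<Rightarrow> real) set"
    show "openp (\<lambda>c z. (open U \<and> open V \<and> U \<inter> V = {}) \<and> fst c \<subseteq> U \<and> z i \<in> V)"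
      by (intro openp_guard openp_conj openp_code openin_code_space openp_in continuous_coordinate) auto
  qed
  show "(\<exists>U V. (open U \<and> open V \<and> U \<inter> V = {}) \<and> fst c \<subseteq> U \<and> z i \<in> V) \<longleftrightarrow> z i \<notin> fst c"
    if "c \<in> topspace code_space" for c z
    by (rule not_in_compact_iff[OF code_spaceD(1)[OF that]])
qed

lemma closedp_in_snd: "closedp (\<lambda>c z. (z i, z j) \<in> snd c)"
proof (rule openp_cong)
  show "openp (\<lambda>c z. \<exists>U V. (open U \<and> open V \<and> U \<inter> V = {}) \<and> snd c \<subseteq> U \<and> (z i, z j) \<in> V)"
  proof (intro openp_ex)
    fix U V :: "((nat \<Rightarrow> real) \<times> (nat \<Rightarrow> real)) set"
    show "openp (\<lambda>c z. (open U \<and> open V \<and> U \<inter> V = {}) \<and> snd c \<subseteq> U \<and> (z i, z j) \<in> V)"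
      by (intro openp_guard openp_conj openp_code openin_code_space(3)[OF open_UNIV] openp_in
          continuous_on_Pair continuous_coordinate) auto
  qed
  show "(\<exists>U V. (open U \<and> open V \<and> U \<inter> V = {}) \<and> snd c \<subseteq> U \<and> (z i, z j) \<in> V) \<longleftrightarrow> (z i, z j) \<notin> snd c"
    if "c \<in> topspace code_space" for c z
    by (rule not_in_compact_iff[OF code_spaceD(4)[OF that]])
qed

text \<open>Components of a compact set are its quasi-components, so failure is witnessed by a cut,
  an open condition on the set and both points. The first two alternatives in the proof cover points
  outside the set.\<close>

lemma closedp_connected: "closedp (\<lambda>c z. connected_component (fst c) (z i) (z j))"
proof (rule openp_cong)
  show "openp (\<lambda>c z. z i \<notin> fst c \<or> z j \<notin> fst c \<or>
      (\<exists>V W. (V, W) \<in> cuts \<and> fst c \<subseteq> V \<union> W \<and> z i \<in> V \<and> z j \<in> W))"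
  proof (intro openp_disj openp_ex closedp_in_fst)
    fix V W :: "(nat \<Rightarrow> real) set"
    show "openp (\<lambda>c z. (V, W) \<in> cuts \<and> fst c \<subseteq> V \<union> W \<and> z i \<in> V \<and> z j \<in> W)"
      using cutsD[of V W]
      by (intro openp_guard openp_conj openp_code openin_code_space openp_in continuous_coordinate) auto
  qed
  show "(z i \<notin> fst c \<or> z j \<notin> fst c \<or> (\<exists>V W. (V, W) \<in> cuts \<and> fst c \<subseteq> V \<union> W \<and> z i \<in> V \<and> z j \<in> W)) \<longleftrightarrow>
      \<not> connected_component (fst c) (z i) (z j)" (is "?L \<longleftrightarrow> ?R")
    if c: "c \<in> topspace code_space" for c and z :: "nat \<Rightarrow> nat \<Rightarrow> real"
  proof
    assume ?L
    then show ?R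
    proof (elim disjE exE conjE)
      fix V W assume VW: "(V, W) \<in> cuts" "fst c \<subseteq> V \<union> W" "z i \<in> V" "z j \<in> W"
      then show ?R using cut_connected_component[OF VW(1,2) _ VW(3)] cutsD(3)[OF VW(1)] by blast
    qed (use connected_component_in in \<open>metis\<close>)+
  next
    assume R: ?R
    then show ?L using separate_cut[OF code_spaceD(1)[OF c], of "z i" "z j"] by metis
  qed
qed

section \<open>Borel predicates of codes\<close>

lemma space_borel_of: "space (borel_of X) = topspace X"
  and sets_borel_of: "sets (borel_of X) = sigma_sets (topspace X) {U. openin X U}"
proof -
  have "{U. openin X U} \<subseteq> Pow (topspace X)" using openin_subset by auto
  then show "space (borel_of X) = topspace X"
    and "sets (borel_of X) = sigma_sets (topspace X) {U. openin X U}"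
    unfolding borel_of_def by (simp_all add: space_measure_of_conv)
qed

lemma borelp_open: "openin code_space {c \<in> topspace code_space. P c} \<Longrightarrow> borelp P"
  unfolding pred_def space_borel_of sets_borel_of by (intro sigma_sets.Basic) simp

lemma borelp_cong:
  assumes "borelp P" "\<And>c. c \<in> topspace code_space \<Longrightarrow> P c \<longleftrightarrow> R c"
  shows "borelp R"
proof -
  have "{c \<in> topspace code_space. P c} = {c \<in> topspace code_space. R c}" using assms(2) by blast
  then show ?thesis using assms(1) unfolding pred_def space_borel_of by simp
qed

lemma borelp_bex:
  assumes "countable I" "\<And>i. i \<in> I \<Longrightarrow> borelp (P i)"
  shows "borelp (\<lambda>c. \<exists>i\<in>I. P i c)"
proof -
  have "(\<Union>i\<in>I. {c \<in> space (borel_of code_space). P i c}) \<in> sets (borel_of code_space)"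
    using assms unfolding pred_def by (intro sets.countable_UN') auto
  moreover have "(\<Union>i\<in>I. {c \<in> space (borel_of code_space). P i c})
      = {c \<in> space (borel_of code_space). \<exists>i\<in>I. P i c}" by blast
  ultimately show ?thesis unfolding pred_def by simp
qed

lemma borelp_not: "borelp P \<Longrightarrow> borelp (\<lambda>c. \<not> P c)"
  by (rule pred_intros_logic)

lemma borelp_ball:
  assumes "countable I" "\<And>i. i \<in> I \<Longrightarrow> borelp (P i)"
  shows "borelp (\<lambda>c. \<forall>i\<in>I. P i c)"
proof -
  have "borelp (\<lambda>c. \<not> (\<exists>i\<in>I. \<not> P i c))" using assms by (intro borelp_not borelp_bex)
  then show ?thesis by simp
qed

text \<open>This is where closedness pays off: for a predicate that is merely Borel, the projection
  would in general only be analytic.\<close>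

lemma borelp_wit:
  assumes "closedp P"
  shows "borelp (\<lambda>c. \<exists>z\<in>seqs hilbert_cube. P c z)"
proof -
  have "compact_space (top_of_set (seqs hilbert_cube))"
    by (simp add: compact_space_subtopology compact_seqs compact_hilbert_cube)
  then have cm: "closed_map wit_space code_space fst"
    unfolding wit_space_def by (rule Abstract_Topological_Spaces.closed_map_fst)
  have "{p \<in> topspace wit_space. P (fst p) (snd p)}
      = topspace wit_space - {p \<in> topspace wit_space. \<not> P (fst p) (snd p)}" by auto
  then have "closedin wit_space {p \<in> topspace wit_space. P (fst p) (snd p)}"
    using closedin_diff[OF closedin_topspace assms[unfolded openp_def]] by simp
  then have "closedin code_space (fst ` {p \<in> topspace wit_space. P (fst p) (snd p)})"
    using cm unfolding closed_map_def by blast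
  moreover have "fst ` {p \<in> topspace wit_space. P (fst p) (snd p)}
      = {c \<in> topspace code_space. \<exists>z\<in>seqs hilbert_cube. P c z}"
    by (force simp: topspace_wit_space)
  ultimately have "openin code_space (topspace code_space - {c \<in> topspace code_space. \<exists>z\<in>seqs hilbert_cube. P c z})"
    unfolding closedin_def by simp
  moreover have "topspace code_space - {c \<in> topspace code_space. \<exists>z\<in>seqs hilbert_cube. P c z}
      = {c \<in> topspace code_space. \<not> (\<exists>z\<in>seqs hilbert_cube. P c z)}" by blast
  ultimately have "openin code_space {c \<in> topspace code_space. \<not> (\<exists>z\<in>seqs hilbert_cube. P c z)}"
    by simp
  then have "borelp (\<lambda>c. \<not> (\<exists>z\<in>seqs hilbert_cube. P c z))" by (rule borelp_open)
  then have "borelp (\<lambda>c. \<not> \<not> (\<exists>z\<in>seqs hilbert_cube. P c z))" by (rule borelp_not)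
  then show ?thesis by simp
qed

lemma borelp_conj: "borelp P \<Longrightarrow> borelp R \<Longrightarrow> borelp (\<lambda>c. P c \<and> R c)"
  and borelp_imp: "borelp P \<Longrightarrow> borelp R \<Longrightarrow> borelp (\<lambda>c. P c \<longrightarrow> R c)"
  by (rule pred_intros_logic(3,4); assumption)+

lemma borelp_fst_subset: "open U \<Longrightarrow> borelp (\<lambda>c. fst c \<subseteq> U)"
  using borelp_open[OF openin_code_space(1)[OF _ open_UNIV]] .

lemma borelp_fst_meets: "open U \<Longrightarrow> borelp (\<lambda>c. fst c \<inter> U \<noteq> {})"
  using borelp_open[OF openin_code_space(2)[OF _ open_UNIV]] .

lemma borelp_snd_subset: "open W \<Longrightarrow> borelp (\<lambda>c. snd c \<subseteq> W)"
  using borelp_open[OF openin_code_space(3)[OF open_UNIV]] .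

section \<open>Borel complexity of the defining conditions\<close>

lemma open_cuts:
  assumes "a \<in> cuts"
  shows "open (fst a)" "open (snd a)"
  using cutsD[of "fst a" "snd a"] assms by auto

text \<open>Four entries are required because \<open>good\<close> compares two big points, each with
  its partner.\<close>

lemma wit_ex:
  assumes "x \<in> Q" "y \<in> Q" "u \<in> Q" "v \<in> Q"
  obtains z where "z \<in> seqs Q" "z 0 = x" "z 1 = y" "z 2 = u" "z 3 = v"
proof
  show "(\<lambda>n::nat. if n = 0 then x else if n = 1 then y else if n = 2 then u else v) \<in> seqs Q"
    using assms by (auto simp: seqs_def)
qed simp_all

text \<open>A compact set is the intersection of its neighbourhoods in \<open>ubase\<close>.
  Inclusion between two sets that both depend on the code thus becomes a countable conjunction of
  conditions involving fixed open sets.\<close>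

lemma subset_compact_iff:
  fixes K :: "'a::{t2_space, second_countable_topology} set"
  assumes "compact K"
  shows "S \<subseteq> K \<longleftrightarrow> (\<forall>V\<in>ubase. K \<subseteq> V \<longrightarrow> S \<subseteq> V)"
proof
  assume R: "\<forall>V\<in>ubase. K \<subseteq> V \<longrightarrow> S \<subseteq> V"
  show "S \<subseteq> K"
  proof (rule subsetI, rule ccontr)
    fix x assume x: "x \<in> S" "x \<notin> K"
    have "open (- {x})" "K \<subseteq> - {x}" using x(2) by auto
    then obtain V where "V \<in> ubase" "K \<subseteq> V" "V \<subseteq> - {x}" using ubase_between[OF assms] by metis
    then show False using R x(1) by blast
  qed
qed blast

lemma borelp_image_subset:
  assumes "\<And>V. V \<in> ubase \<Longrightarrow> borelp (\<lambda>c. A c \<subseteq> V)" "\<And>V. V \<in> ubase \<Longrightarrow> borelp (\<lambda>c. B c \<subseteq> V)"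
    and "\<And>c. c \<in> topspace code_space \<Longrightarrow> compact (B c)"
  shows "borelp (\<lambda>c. A c \<subseteq> (B c :: 'a::{t2_space, second_countable_topology} set))"
proof (rule borelp_cong)
  show "borelp (\<lambda>c. \<forall>V\<in>ubase. B c \<subseteq> V \<longrightarrow> A c \<subseteq> V)"
    using assms by (intro borelp_ball countable_ubase borelp_imp)
  show "(\<forall>V\<in>ubase. B c \<subseteq> V \<longrightarrow> A c \<subseteq> V) \<longleftrightarrow> A c \<subseteq> B c" if "c \<in> topspace code_space" for c
    using subset_compact_iff[OF assms(3)[OF that]] by blast
qed

definition bijective_graph :: "'a set \<Rightarrow> ('a \<times> 'a) set \<Rightarrow> bool" where
  "bijective_graph C G \<longleftrightarrow> fst ` G = C \<and> snd ` G = C \<and> inj_on fst G \<and> inj_on snd G"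

text \<open>On a compact \<open>G\<close> an injective projection is a homeomorphism onto its image,
  so continuity of the map and of its inverse come for free and \<open>h\<close> disappears from the
  condition.\<close>

lemma bijective_graph_iff:
  fixes C :: "'a::metric_space set"
  assumes C: "compact C" and G: "compact G"
  shows "bijective_graph C G \<longleftrightarrow> (\<exists>h. G = graph_on C h \<and> invertible_system C h)"
proof
  assume "bijective_graph C G"
  then have b: "fst ` G = C" "snd ` G = C" "inj_on fst G" "inj_on snd G"
    unfolding bijective_graph_def by auto
  obtain p where p: "homeomorphism G C fst p"
    using homeomorphism_compact[OF G continuous_on_fst[OF continuous_on_id] b(1,3)] by blast
  obtain q where q: "homeomorphism G C snd q"
    using homeomorphism_compact[OF G continuous_on_snd[OF continuous_on_id] b(2,4)] by blast
  have "homeomorphism C C (snd \<circ> p) (fst \<circ> q)"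
    using homeomorphism_compose[OF homeomorphism_symD[OF p] q] .
  moreover have "G = graph_on C (snd \<circ> p)"
  proof (intro set_eqI iffI)
    fix w assume w: "w \<in> G"
    then have "p (fst w) = w" using homeomorphism_apply1[OF p] by blast
    then have "w = (fst w, (snd \<circ> p) (fst w))" by simp
    then show "w \<in> graph_on C (snd \<circ> p)" using w b(1) unfolding graph_on_def by blast
  next
    fix w assume "w \<in> graph_on C (snd \<circ> p)"
    then obtain x where x: "x \<in> C" "w = (x, snd (p x))" unfolding graph_on_def by auto
    have "p x \<in> G" using homeomorphism_image2[OF p] x(1) by blast
    moreover have "w = p x" using homeomorphism_apply2[OF p x(1)] x(2) by (metis prod.collapse)
    ultimately show "w \<in> G" by simp
  qed
  ultimately show "\<exists>h. G = graph_on C h \<and> invertible_system C h"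
    using C unfolding invertible_system_def by blast
next
  assume "\<exists>h. G = graph_on C h \<and> invertible_system C h"
  then obtain h g where h: "G = graph_on C h" "homeomorphism C C h g"
    unfolding invertible_system_def by blast
  have "G = (\<lambda>x. (x, h x)) ` C" unfolding h(1) graph_on_def by blast
  moreover have "h ` C = C" using homeomorphism_image1[OF h(2)] .
  moreover have "inj_on h C" using homeomorphism_apply1[OF h(2)] by (rule inj_on_inverseI)
  ultimately show "bijective_graph C G"
    unfolding bijective_graph_def by (simp add: image_image inj_on_def)
qed

text \<open>Being distinct is not a closed condition, but being at distance at least
  \<open>1 / Suc n\<close> is; the countable quantifier over \<open>n\<close> recovers it.\<close>

lemma inj_on_wit_iff:
  fixes G :: "((nat \<Rightarrow> real) \<times> (nat \<Rightarrow> real)) set"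
  assumes "G \<subseteq> Q \<times> Q"
  shows "inj_on fst G \<longleftrightarrow> (\<forall>n. \<not> (\<exists>z\<in>seqs Q. (z 0, z 1) \<in> G \<and> (z 0, z 2) \<in> G \<and> 1 / Suc n \<le> dist (z 1) (z 2)))"
    and "inj_on snd G \<longleftrightarrow> (\<forall>n. \<not> (\<exists>z\<in>seqs Q. (z 1, z 0) \<in> G \<and> (z 2, z 0) \<in> G \<and> 1 / Suc n \<le> dist (z 1) (z 2)))"
proof -
  have pos: "(\<exists>n. 1 / Suc n \<le> dist y y') \<longleftrightarrow> y \<noteq> y'" for y y' :: "nat \<Rightarrow> real"
  proof
    assume "y \<noteq> y'"
    then obtain n where "1 / Suc n < dist y y'" using nat_approx_posE[of "dist y y'"] by auto
    then show "\<exists>n. 1 / Suc n \<le> dist y y'" using less_imp_le by blast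
  qed (auto simp: not_le)
  have wit: "(\<exists>z\<in>seqs Q. R (z 0) (z 1) \<and> R (z 0) (z 2) \<and> S (z 1) (z 2)) \<longleftrightarrow> (\<exists>x y y'. R x y \<and> R x y' \<and> S y y')"
    if R_in: "\<And>x y. R x y \<Longrightarrow> x \<in> Q \<and> y \<in> Q" for R and S :: "(nat \<Rightarrow> real) \<Rightarrow> (nat \<Rightarrow> real) \<Rightarrow> bool"
  proof
    assume "\<exists>x y y'. R x y \<and> R x y' \<and> S y y'"
    then obtain x y y' where *: "R x y" "R x y'" "S y y'" by blast
    obtain z where "z \<in> seqs Q" "z 0 = x" "z 1 = y" "z 2 = y'" "z 3 = x"
      using wit_ex[of x Q y y' x] R_in[OF *(1)] R_in[OF *(2)] by blast
    then show "\<exists>z\<in>seqs Q. R (z 0) (z 1) \<and> R (z 0) (z 2) \<and> S (z 1) (z 2)" using * by auto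
  qed blast
  show "inj_on fst G \<longleftrightarrow> (\<forall>n. \<not> (\<exists>z\<in>seqs Q. (z 0, z 1) \<in> G \<and> (z 0, z 2) \<in> G \<and> 1 / Suc n \<le> dist (z 1) (z 2)))"
  proof -
    have "(\<exists>z\<in>seqs Q. (z 0, z 1) \<in> G \<and> (z 0, z 2) \<in> G \<and> 1 / Suc n \<le> dist (z 1) (z 2)) \<longleftrightarrow>
        (\<exists>x y y'. (x, y) \<in> G \<and> (x, y') \<in> G \<and> 1 / Suc n \<le> dist y y')" for n
      by (rule wit[of "\<lambda>x y. (x, y) \<in> G" "\<lambda>y y'. 1 / Suc n \<le> dist y y'"]) (use assms in blast)
    then have "(\<forall>n. \<not> (\<exists>z\<in>seqs Q. (z 0, z 1) \<in> G \<and> (z 0, z 2) \<in> G \<and> 1 / Suc n \<le> dist (z 1) (z 2))) \<longleftrightarrow>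
        (\<forall>x y y'. (x, y) \<in> G \<longrightarrow> (x, y') \<in> G \<longrightarrow> \<not> (\<exists>n. 1 / Suc n \<le> dist y y'))" by blast
    also have "\<dots> \<longleftrightarrow> inj_on fst G" unfolding pos inj_on_def by fastforce
    finally show ?thesis by blast
  qed
  show "inj_on snd G \<longleftrightarrow> (\<forall>n. \<not> (\<exists>z\<in>seqs Q. (z 1, z 0) \<in> G \<and> (z 2, z 0) \<in> G \<and> 1 / Suc n \<le> dist (z 1) (z 2)))"
  proof -
    have "(\<exists>z\<in>seqs Q. (z 1, z 0) \<in> G \<and> (z 2, z 0) \<in> G \<and> 1 / Suc n \<le> dist (z 1) (z 2)) \<longleftrightarrow>
        (\<exists>x y y'. (y, x) \<in> G \<and> (y', x) \<in> G \<and> 1 / Suc n \<le> dist y y')" for n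
      by (rule wit[of "\<lambda>x y. (y, x) \<in> G" "\<lambda>y y'. 1 / Suc n \<le> dist y y'"]) (use assms in blast)
    then have "(\<forall>n. \<not> (\<exists>z\<in>seqs Q. (z 1, z 0) \<in> G \<and> (z 2, z 0) \<in> G \<and> 1 / Suc n \<le> dist (z 1) (z 2))) \<longleftrightarrow>
        (\<forall>x y y'. (y, x) \<in> G \<longrightarrow> (y', x) \<in> G \<longrightarrow> \<not> (\<exists>n. 1 / Suc n \<le> dist y y'))" by blast
    also have "\<dots> \<longleftrightarrow> inj_on snd G" unfolding pos inj_on_def by fastforce
    finally show ?thesis by blast
  qed
qed

lemma borelp_bijective_graph: "borelp (\<lambda>c. bijective_graph (fst c) (snd c))"
proof -
  have f: "borelp (\<lambda>c. fst ` snd c \<subseteq> V)" if "V \<in> ubase" for V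
    using borelp_snd_subset[OF open_Times[OF open_ubase[OF that] open_UNIV]]
    by (rule borelp_cong) (auto simp: subset_iff)
  have s: "borelp (\<lambda>c. snd ` snd c \<subseteq> V)" if "V \<in> ubase" for V
    using borelp_snd_subset[OF open_Times[OF open_UNIV open_ubase[OF that]]]
    by (rule borelp_cong) (auto simp: subset_iff)
  have v: "borelp (\<lambda>c. fst c \<subseteq> V)" if "V \<in> ubase" for V
    using borelp_fst_subset[OF open_ubase[OF that]] .
  have cpt: "compact (fst c)" "compact (fst ` snd c)" "compact (snd ` snd c)"
    if "c \<in> topspace code_space" for c
    using code_spaceD[OF that]
    by (auto intro!: compact_continuous_image continuous_on_fst continuous_on_snd continuous_on_id)
  have i: "borelp (\<lambda>c. inj_on fst (snd c))"
  proof (rule borelp_cong)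
    show "borelp (\<lambda>c. \<forall>n. \<not> (\<exists>z\<in>seqs hilbert_cube. (z 0, z 1) \<in> snd c \<and> (z 0, z 2) \<in> snd c \<and>
        1 / Suc n \<le> dist (z 1) (z 2)))"
      by (intro pred_intros_countable borelp_not borelp_wit closedp_conj closedp_in_snd closedp_dist_ge)
  qed (rule inj_on_wit_iff(1)[OF code_spaceD(6), symmetric])
  have j: "borelp (\<lambda>c. inj_on snd (snd c))"
  proof (rule borelp_cong)
    show "borelp (\<lambda>c. \<forall>n. \<not> (\<exists>z\<in>seqs hilbert_cube. (z 1, z 0) \<in> snd c \<and> (z 2, z 0) \<in> snd c \<and>
        1 / Suc n \<le> dist (z 1) (z 2)))"
      by (intro pred_intros_countable borelp_not borelp_wit closedp_conj closedp_in_snd closedp_dist_ge)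
  qed (rule inj_on_wit_iff(2)[OF code_spaceD(6), symmetric])
  show ?thesis
    unfolding bijective_graph_def set_eq_subset
    using borelp_image_subset[OF f v cpt(1)] borelp_image_subset[OF v f cpt(2)]
      borelp_image_subset[OF s v cpt(1)] borelp_image_subset[OF v s cpt(3)] i j
    by (intro borelp_conj)
qed

lemma borelp_perfect: "borelp (\<lambda>c. \<nexists>x. x isolated_in fst c)"
  unfolding perfect_iff
proof (intro borelp_ball borelp_bex countable_ubase)
  fix U :: "(nat \<Rightarrow> real) set" assume U: "U \<in> ubase"
  show "borelp (\<lambda>c. fst c \<inter> U \<noteq> {} \<longrightarrow> (\<exists>V\<in>ubase. \<exists>W\<in>ubase. V \<inter> W = {} \<and> V \<subseteq> U \<and> W \<subseteq> U \<and>
      fst c \<inter> V \<noteq> {} \<and> fst c \<inter> W \<noteq> {}))"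
    using U by (intro borelp_imp borelp_conj borelp_bex countable_ubase borelp_fst_meets open_ubase
        measurable_const) simp_all
qed

lemma borelp_dense_degenerate:
  "borelp (\<lambda>c. fst c \<subseteq> closure (\<Union>{D \<in> components (fst c). is_singleton D}))"
proof (rule borelp_cong)
  show "borelp (\<lambda>c. \<forall>n. \<forall>U\<in>ubase. fst c \<inter> U \<noteq> {} \<longrightarrow>
      (\<exists>VW\<in>cuts. small n (fst VW) \<and> fst c \<subseteq> fst VW \<union> snd VW \<and> fst c \<inter> (fst VW \<inter> U) \<noteq> {}))"
    by (intro pred_intros_countable borelp_ball borelp_imp borelp_conj borelp_bex countable_ubase countable_cuts
        borelp_fst_meets borelp_fst_subset open_Int open_Un measurable_const)
      (simp_all add: open_ubase open_cuts)
qed (use dense_degenerate_iff[OF code_spaceD(1)] in \<open>simp add: case_prod_beta\<close>)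

lemma big_wit_iff:
  assumes "C \<subseteq> Q"
  shows "(\<exists>z\<in>seqs Q. connected_component C (z 0) (z 1) \<and> 1 / Suc k \<le> dist (z 0) (z 1) \<and> z 0 \<notin> U)
    \<longleftrightarrow> \<not> big k C \<subseteq> U"
proof
  assume "\<not> big k C \<subseteq> U"
  then obtain x y where xy: "connected_component C x y" "1 / Suc k \<le> dist x y" "x \<notin> U"
    unfolding big_def by auto
  then have "x \<in> Q" "y \<in> Q" using connected_component_in[OF xy(1)] assms by auto
  then obtain z where "z \<in> seqs Q" "z 0 = x" "z 1 = y" using wit_ex[of x Q y x x] by metis
  then show "\<exists>z\<in>seqs Q. connected_component C (z 0) (z 1) \<and> 1 / Suc k \<le> dist (z 0) (z 1) \<and> z 0 \<notin> U"
    using xy by blast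
qed (auto simp: big_def)

lemma borelp_big_subset:
  assumes "open U"
  shows "borelp (\<lambda>c. big k (fst c) \<subseteq> U)"
proof (rule borelp_cong)
  show "borelp (\<lambda>c. \<not> (\<exists>z\<in>seqs hilbert_cube. connected_component (fst c) (z 0) (z 1) \<and>
      1 / Suc k \<le> dist (z 0) (z 1) \<and> z 0 \<notin> U))"
    by (intro borelp_not borelp_wit closedp_conj closedp_connected closedp_dist_ge closedp_not_in assms)
qed (use big_wit_iff[OF code_spaceD(3)] in blast)

text \<open>Failure asks for two big points in different components, and being in different
  components is the negation of a closed condition. Naming a cut \<open>b\<close> that separates
  them, with each point avoiding one side, turns it into a countable union of closed
  conditions.\<close>

lemma good_wit_iff:
  fixes C :: "(nat \<Rightarrow> real) set"
  assumes C: "compact C" "C \<subseteq> Q"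
  shows "good k a C \<longleftrightarrow> C \<subseteq> fst a \<union> snd a \<and> \<not> (\<exists>b\<in>cuts. C \<subseteq> fst b \<union> snd b \<and>
    (\<exists>z\<in>seqs Q. connected_component C (z 0) (z 1) \<and> 1 / Suc k \<le> dist (z 0) (z 1) \<and> z 0 \<notin> snd a \<and> z 0 \<notin> snd b \<and>
       connected_component C (z 2) (z 3) \<and> 1 / Suc k \<le> dist (z 2) (z 3) \<and> z 2 \<notin> snd a \<and> z 2 \<notin> fst b))"
    (is "_ \<longleftrightarrow> _ \<and> \<not> ?E")
proof -
  have "?E \<longleftrightarrow> \<not> (\<forall>x\<in>big k C - snd a. \<forall>y\<in>big k C - snd a. connected_component C x y)" (is "_ \<longleftrightarrow> \<not> ?A")
  proof
    assume ?E
    then obtain b z where b: "b \<in> cuts" "C \<subseteq> fst b \<union> snd b" and z: "z \<in> seqs Q"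
       "connected_component C (z 0) (z 1)" "1 / Suc k \<le> dist (z 0) (z 1)" "z 0 \<notin> snd a" "z 0 \<notin> snd b"
       "connected_component C (z 2) (z 3)" "1 / Suc k \<le> dist (z 2) (z 3)" "z 2 \<notin> snd a" "z 2 \<notin> fst b" by blast
    have "z 0 \<in> big k C - snd a" "z 2 \<in> big k C - snd a" using z unfolding big_def by auto
    moreover have "\<not> connected_component C (z 0) (z 2)"
      using cut_connected_component[of "fst b" "snd b" C "z 0" "z 2"] b z connected_component_in[OF z(2)] by auto
    ultimately show "\<not> ?A" by blast
  next
    assume "\<not> ?A"
    then obtain x u where xu: "x \<in> big k C" "x \<notin> snd a" "u \<in> big k C" "u \<notin> snd a"
      "\<not> connected_component C x u" by blast
    then obtain y v where y: "connected_component C x y" "1 / Suc k \<le> dist x y"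
      and v: "connected_component C u v" "1 / Suc k \<le> dist u v" unfolding big_def by blast
    note xy = connected_component_in[OF y(1)] connected_component_in[OF v(1)]
    obtain V W where VW: "(V, W) \<in> cuts" "C \<subseteq> V \<union> W" "x \<in> V" "u \<in> W"
      using separate_cut[OF C(1) _ _ xu(5)] xy by blast
    have "x \<notin> W" "u \<notin> V" using VW cutsD(3)[OF VW(1)] by auto
    moreover obtain z where "z \<in> seqs Q" "z 0 = x" "z 1 = y" "z 2 = u" "z 3 = v"
      using wit_ex[of x Q y u v] xy C(2) by blast
    ultimately show ?E
      using xu y v VW by (intro bexI[of _ "(V, W)"] conjI bexI[of _ z]) simp_all
  qed
  then show ?thesis unfolding good_def by blast
qed

lemma borelp_good:
  assumes "a \<in> cuts"
  shows "borelp (\<lambda>c. good k a (fst c))"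
proof (rule borelp_cong)
  show "borelp (\<lambda>c. fst c \<subseteq> fst a \<union> snd a \<and> \<not> (\<exists>b\<in>cuts. fst c \<subseteq> fst b \<union> snd b \<and>
    (\<exists>z\<in>seqs hilbert_cube. connected_component (fst c) (z 0) (z 1) \<and> 1 / Suc k \<le> dist (z 0) (z 1) \<and>
       z 0 \<notin> snd a \<and> z 0 \<notin> snd b \<and>
       connected_component (fst c) (z 2) (z 3) \<and> 1 / Suc k \<le> dist (z 2) (z 3) \<and> z 2 \<notin> snd a \<and> z 2 \<notin> fst b)))"
    by (intro borelp_conj borelp_not borelp_bex countable_cuts borelp_fst_subset borelp_wit
        closedp_conj closedp_connected closedp_dist_ge closedp_not_in open_Un open_cuts assms)
qed (rule good_wit_iff[OF code_spaceD(1,3), symmetric])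

lemma borelp_tame:
  "borelp (\<lambda>c. \<forall>\<epsilon>>0. finite {D \<in> components (fst c). diameter D \<ge> \<epsilon>})"
proof (rule borelp_cong)
  have "countable {I :: ((nat \<Rightarrow> real) set \<times> (nat \<Rightarrow> real) set) set. finite I \<and> I \<subseteq> cuts}"
    by (rule countable_Collect_finite_subset[OF countable_cuts])
  moreover have "open (\<Union>(fst ` I))" if "I \<subseteq> cuts" for I :: "((nat \<Rightarrow> real) set \<times> (nat \<Rightarrow> real) set) set"
    using that open_cuts(1) by (intro open_Union) blast
  ultimately show "borelp (\<lambda>c. \<forall>k. \<exists>I\<in>{I. finite I \<and> I \<subseteq> cuts}.
      (\<forall>a\<in>I. good k a (fst c)) \<and> big k (fst c) \<subseteq> \<Union>(fst ` I))"
    by (intro pred_intros_countable borelp_bex borelp_conj borelp_ball borelp_good borelp_big_subset)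
      (auto intro: countable_finite)
qed (rule tame_iff[OF code_spaceD(1), symmetric])

section \<open>Minimality in terms of graphs, and the Borel set of codes\<close>

lemma graph_chain:
  assumes "\<And>i. i < n \<Longrightarrow> (z i, z (Suc i)) \<in> graph_on C h"
  shows "i \<le> n \<Longrightarrow> z i = (h ^^ i) (z 0)"
proof (induction i)
  case (Suc i)
  then show ?case using assms[of i] unfolding graph_on_def by auto
qed simp

text \<open>The coordinates of the witness are the orbit itself, so the iterates of \<open>h\<close>
  are expressed through the graph alone. The edge at \<open>i = N\<close> leads one step beyond the
  segment; it always exists, as \<open>h\<close> maps \<open>C\<close> into itself.\<close>

lemma minimal_wit_iff:
  assumes h: "h ` C \<subseteq> C" "C \<subseteq> Q" and G: "G = graph_on C h"
  shows "(\<exists>z\<in>seqs Q. z 0 \<in> C \<and> (\<forall>i. i \<le> N \<longrightarrow> z i \<notin> U \<and> (z i, z (Suc i)) \<in> G)) \<longleftrightarrow>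
    \<not> (\<forall>x\<in>C. \<exists>i\<le>N. (h ^^ i) x \<in> U)"
proof
  assume "\<exists>z\<in>seqs Q. z 0 \<in> C \<and> (\<forall>i. i \<le> N \<longrightarrow> z i \<notin> U \<and> (z i, z (Suc i)) \<in> G)"
  then obtain z where z: "z 0 \<in> C" "\<And>i. i \<le> N \<Longrightarrow> z i \<notin> U" "\<And>i. i \<le> N \<Longrightarrow> (z i, z (Suc i)) \<in> graph_on C h"
    unfolding G by blast
  have "(h ^^ i) (z 0) \<notin> U" if "i \<le> N" for i
    using z(2)[OF that] graph_chain[of N z C h i] z(3) that by simp
  then show "\<not> (\<forall>x\<in>C. \<exists>i\<le>N. (h ^^ i) x \<in> U)" using z(1) by blast
next
  assume "\<not> (\<forall>x\<in>C. \<exists>i\<le>N. (h ^^ i) x \<in> U)"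
  then obtain x where x: "x \<in> C" "\<And>i. i \<le> N \<Longrightarrow> (h ^^ i) x \<notin> U" by blast
  have "(h ^^ i) x \<in> C" for i using iterate_in[OF h(1) x(1)] .
  then show "\<exists>z\<in>seqs Q. z 0 \<in> C \<and> (\<forall>i. i \<le> N \<longrightarrow> z i \<notin> U \<and> (z i, z (Suc i)) \<in> G)"
    using x h(2) unfolding G graph_on_def seqs_def
    by (intro bexI[of _ "\<lambda>i. (h ^^ i) x"]) auto
qed

text \<open>Stated for every pair of compact sets, so that its Borel complexity can be found
  separately; it expresses minimality once \<open>snd c\<close> is known to be the graph of an
  invertible system on \<open>fst c\<close>.\<close>

definition minimal_code :: "system_code \<Rightarrow> bool" where
  "minimal_code c \<longleftrightarrow> (\<forall>U\<in>ubase. fst c \<inter> U \<noteq> {} \<longrightarrow> (\<exists>N. \<not> (\<exists>z\<in>seqs hilbert_cube. z 0 \<in> fst c \<and>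
      (\<forall>i. i \<le> N \<longrightarrow> z i \<notin> U \<and> (z i, z (Suc i)) \<in> snd c))))"

lemma borelp_minimal_code: "borelp minimal_code"
  unfolding minimal_code_def[abs_def]
  by (intro borelp_ball countable_ubase borelp_imp borelp_fst_meets open_ubase pred_intros_countable
      borelp_not borelp_wit closedp_conj closedp_in_fst closedp_all closedp_imp closedp_not_in closedp_in_snd)

text \<open>Within \<open>code_space\<close> every conjunct is a Borel predicate, and no map
  \<open>h\<close> is left. Nonemptiness of \<open>fst c\<close> is part of belonging to
  \<open>code_space\<close>; nonemptiness of \<open>big k (fst c)\<close> is written as a failed
  inclusion into an open set, the form known to be Borel.\<close>

lemma minimal_tame_codes_iff:
  "c \<in> minimal_tame_codes \<longleftrightarrow> c \<in> topspace code_space \<and> bijective_graph (fst c) (snd c) \<and>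
    (\<nexists>x. x isolated_in fst c) \<and> fst c \<subseteq> closure (\<Union>{D \<in> components (fst c). is_singleton D}) \<and>
    (\<forall>\<epsilon>>0. finite {D \<in> components (fst c). diameter D \<ge> \<epsilon>}) \<and>
    (\<exists>k. \<not> big k (fst c) \<subseteq> {}) \<and> minimal_code c" (is "_ \<longleftrightarrow> ?R")
proof -
  have min: "minimal_system C h \<longleftrightarrow> minimal_code (C, graph_on C h)"
    if "invertible_system C h" "C \<subseteq> hilbert_cube" for C h
  proof -
    have C: "compact C" using that(1) unfolding invertible_system_def by blast
    obtain g where g: "homeomorphism C C h g" using \<open>invertible_system C h\<close> unfolding invertible_system_def by blast
    have hC: "continuous_on C h" "h ` C \<subseteq> C" using homeomorphism_cont1[OF g] homeomorphism_image1[OF g] by auto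
    show ?thesis
      unfolding minimal_iff[OF C hC] minimal_code_def fst_conv snd_conv
        minimal_wit_iff[OF hC(2) that(2) refl] not_not ..
  qed
  have core: "tame_cantoroid C \<and> \<not> C homeomorphic cantor_space \<longleftrightarrow>
    C \<noteq> {} \<and> compact C \<and> (\<nexists>x. x isolated_in C) \<and> C \<subseteq> closure (\<Union>{D \<in> components C. is_singleton D}) \<and>
    (\<forall>\<epsilon>>0. finite {D \<in> components C. diameter D \<ge> \<epsilon>}) \<and> (\<exists>k. \<not> big k C \<subseteq> {})"
    for C :: "(nat \<Rightarrow> real) set"
    unfolding tame_cantoroid_def cantoroid_def subset_empty using not_cantor_space_iff[of C] by blast
  show ?thesis
  proof
    assume "c \<in> minimal_tame_codes"
    then obtain C h where c: "c = (C, graph_on C h)" "C \<subseteq> hilbert_cube" "tame_cantoroid C"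
      "\<not> C homeomorphic cantor_space" "invertible_system C h" "minimal_system C h"
      unfolding minimal_tame_codes_def by blast
    have C: "C \<noteq> {}" "compact C" using core[of C] c(3,4) by blast+
    have hC: "continuous_on C h" "h ` C \<subseteq> C" using minimal_systemD[OF c(6)] by auto
    have G: "graph_on C h = (\<lambda>x. (x, h x)) ` C" unfolding graph_on_def by blast
    have "compact (graph_on C h)"
      unfolding G by (intro compact_continuous_image continuous_on_Pair continuous_on_id hC C)
    moreover have "graph_on C h \<noteq> {}" "graph_on C h \<subseteq> hilbert_cube \<times> hilbert_cube"
      unfolding G using C(1) hC(2) c(2) by auto
    ultimately have top: "c \<in> topspace code_space"
      unfolding topspace_code_space compacts_def c(1) using C c(2) by simp
    moreover have "bijective_graph C (graph_on C h)"
      using bijective_graph_iff[OF C(2) \<open>compact (graph_on C h)\<close>] c(5) by blast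
    ultimately show ?R using core[of C] c(3,4,6) min[OF c(5,2)] unfolding c(1) fst_conv snd_conv by blast
  next
    assume R: ?R
    then have C: "compact (fst c)" "fst c \<noteq> {}" "fst c \<subseteq> hilbert_cube" "compact (snd c)"
      using code_spaceD by blast+
    obtain h where h: "snd c = graph_on (fst c) h" "invertible_system (fst c) h"
      using bijective_graph_iff[OF C(1,4)] R by blast
    have c: "c = (fst c, graph_on (fst c) h)" using h(1) by (metis prod.collapse)
    have "minimal_system (fst c) h" using min[OF h(2) C(3)] R c by metis
    moreover have "tame_cantoroid (fst c) \<and> \<not> fst c homeomorphic cantor_space"
      unfolding core using R C by blast
    ultimately show "c \<in> minimal_tame_codes"
      unfolding minimal_tame_codes_def using c C(3) h(2) by blast
  qed
qed

lemma minimal_tame_codes_borel: "minimal_tame_codes \<in> sets (borel_of code_space)"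
proof -
  have "borelp (\<lambda>c. bijective_graph (fst c) (snd c) \<and>
    (\<nexists>x. x isolated_in fst c) \<and> fst c \<subseteq> closure (\<Union>{D \<in> components (fst c). is_singleton D}) \<and>
    (\<forall>\<epsilon>>0. finite {D \<in> components (fst c). diameter D \<ge> \<epsilon>}) \<and>
    (\<exists>k. \<not> big k (fst c) \<subseteq> {}) \<and> minimal_code c)"
    by (intro borelp_conj borelp_bijective_graph borelp_perfect borelp_dense_degenerate borelp_tame
        borelp_minimal_code pred_intros_countable borelp_not borelp_big_subset open_empty)
  then show ?thesis
    unfolding pred_def space_borel_of minimal_tame_codes_iff[symmetric] by simp
qed

section \<open>Conjugacy of codes\<close>

lemma minimal_tame_codesE:
  assumes "c \<in> minimal_tame_codes"
  obtains C h where "c = (C, graph_on C h)" "C \<subseteq> hilbert_cube" "tame_cantoroid C"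
    "\<not> C homeomorphic cantor_space" "invertible_system C h" "minimal_system C h"
  using assms unfolding minimal_tame_codes_def by blast

lemma graph_on_eqD: "graph_on C h = graph_on C k \<Longrightarrow> x \<in> C \<Longrightarrow> h x = k x"
  unfolding graph_on_def by (auto simp: set_eq_iff)

lemma conjugate_systems_sym:
  assumes "h ` C \<subseteq> C" "conjugate_systems C h D k"
  shows "conjugate_systems D k C h"
proof -
  obtain \<phi> \<psi> where *: "homeomorphism C D \<phi> \<psi>" "\<And>x. x \<in> C \<Longrightarrow> \<phi> (h x) = k (\<phi> x)"
    using assms(2) unfolding conjugate_systems_def by blast
  have "\<psi> (k y) = h (\<psi> y)" if y: "y \<in> D" for y
  proof -
    have "\<psi> y \<in> C" using homeomorphism_image2[OF *(1)] y by blast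
    moreover have "k y = \<phi> (h (\<psi> y))" using *(2)[OF calculation] homeomorphism_apply2[OF *(1) y] by simp
    moreover have "h (\<psi> y) \<in> C" using calculation(1) assms(1) by blast
    ultimately show ?thesis using homeomorphism_apply1[OF *(1)] by simp
  qed
  then show ?thesis unfolding conjugate_systems_def using homeomorphism_symD[OF *(1)] by blast
qed

lemma conjugate_systems_trans:
  assumes "conjugate_systems C h D k" "conjugate_systems D k E l"
  shows "conjugate_systems C h E l"
proof -
  obtain \<phi> \<psi> where 1: "homeomorphism C D \<phi> \<psi>" "\<And>x. x \<in> C \<Longrightarrow> \<phi> (h x) = k (\<phi> x)"
    using assms(1) unfolding conjugate_systems_def by blast
  obtain \<phi>' \<psi>' where 2: "homeomorphism D E \<phi>' \<psi>'" "\<And>x. x \<in> D \<Longrightarrow> \<phi>' (k x) = l (\<phi>' x)"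
    using assms(2) unfolding conjugate_systems_def by blast
  have "(\<phi>' \<circ> \<phi>) (h x) = l ((\<phi>' \<circ> \<phi>) x)" if x: "x \<in> C" for x
  proof -
    have "\<phi> x \<in> D" using homeomorphism_image1[OF 1(1)] x by blast
    then show ?thesis using 1(2)[OF x] 2(2) by simp
  qed
  then show ?thesis unfolding conjugate_systems_def using homeomorphism_compose[OF 1(1) 2(1)] by blast
qed

lemma conjugate_systems_cong:
  assumes "conjugate_systems C h D k" "\<And>x. x \<in> C \<Longrightarrow> h x = h' x" "\<And>x. x \<in> D \<Longrightarrow> k x = k' x"
  shows "conjugate_systems C h' D k'"
proof -
  obtain \<phi> \<psi> where *: "homeomorphism C D \<phi> \<psi>" "\<And>x. x \<in> C \<Longrightarrow> \<phi> (h x) = k (\<phi> x)"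
    using assms(1) unfolding conjugate_systems_def by blast
  have "\<phi> (h' x) = k' (\<phi> x)" if x: "x \<in> C" for x
  proof -
    have "\<phi> x \<in> D" using homeomorphism_image1[OF *(1)] x by blast
    then show ?thesis using *(2)[OF x] assms(2)[OF x] assms(3) by simp
  qed
  then show ?thesis unfolding conjugate_systems_def using *(1) by blast
qed

text \<open>A graph determines its map only on the underlying set, while \<open>conjugacy\<close>
  quantifies over the maps; the choice of the representatives has to be shown irrelevant.\<close>

lemma conjugacy_iff:
  "((C, graph_on C h), (D, graph_on D k)) \<in> conjugacy \<longleftrightarrow>
    (C, graph_on C h) \<in> minimal_tame_codes \<and> (D, graph_on D k) \<in> minimal_tame_codes \<and>
    conjugate_systems C h D k"
proof
  assume "((C, graph_on C h), (D, graph_on D k)) \<in> conjugacy"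
  then obtain h' k' where *: "graph_on C h = graph_on C h'" "graph_on D k = graph_on D k'"
      "(C, graph_on C h) \<in> minimal_tame_codes" "(D, graph_on D k) \<in> minimal_tame_codes"
      "conjugate_systems C h' D k'"
    unfolding conjugacy_def by auto
  have "conjugate_systems C h D k"
    using conjugate_systems_cong[OF *(5)] graph_on_eqD[OF *(1)] graph_on_eqD[OF *(2)] by metis
  then show "(C, graph_on C h) \<in> minimal_tame_codes \<and> (D, graph_on D k) \<in> minimal_tame_codes \<and>
    conjugate_systems C h D k" using * by blast
qed (auto simp: conjugacy_def)

lemma equiv_conjugacy: "equiv minimal_tame_codes conjugacy"
proof (rule equivI)
  show "conjugacy \<subseteq> minimal_tame_codes \<times> minimal_tame_codes" unfolding conjugacy_def by blast
  show "refl_on minimal_tame_codes conjugacy"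
  proof (rule refl_onI)
    fix c assume c: "c \<in> minimal_tame_codes"
    then obtain C h where Ch: "c = (C, graph_on C h)" by (rule minimal_tame_codesE)
    have "conjugate_systems C h C h"
      unfolding conjugate_systems_def using homeomorphism_ident[of C] by (intro exI[of _ "\<lambda>x. x"]) auto
    then show "(c, c) \<in> conjugacy" using c unfolding Ch conjugacy_iff by blast
  qed
  show "sym conjugacy"
  proof (rule symI)
    fix c d assume cd: "(c, d) \<in> conjugacy"
    then have "c \<in> minimal_tame_codes" "d \<in> minimal_tame_codes" unfolding conjugacy_def by auto
    then obtain C h D k where c: "c = (C, graph_on C h)" "minimal_system C h" and d: "d = (D, graph_on D k)"
      by (elim minimal_tame_codesE)
    show "(d, c) \<in> conjugacy"
      using cd conjugate_systems_sym[OF minimal_systemD(3)[OF c(2)]] unfolding c(1) d conjugacy_iff by blast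
  qed
  show "trans conjugacy"
  proof (rule transI)
    fix c d e assume cde: "(c, d) \<in> conjugacy" "(d, e) \<in> conjugacy"
    then have "c \<in> minimal_tame_codes" "d \<in> minimal_tame_codes" "e \<in> minimal_tame_codes"
      unfolding conjugacy_def by auto
    then obtain C h D k E l where c: "c = (C, graph_on C h)" and d: "d = (D, graph_on D k)"
      and e: "e = (E, graph_on E l)"
      by (elim minimal_tame_codesE)
    show "(c, e) \<in> conjugacy"
      using cde conjugate_systems_trans unfolding c d e conjugacy_iff by blast
  qed
qed

lemma equiv_jump:
  assumes "equiv A E"
  shows "equiv (seqs A) (jump E)"
proof (rule equivI)
  obtain E: "E \<subseteq> A \<times> A" "refl_on A E" "sym E" "trans E" using assms by (rule equivE)
  show "jump E \<subseteq> seqs A \<times> seqs A" using E(1) unfolding jump_def seqs_def by blast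
  show "refl_on (seqs A) (jump E)"
    using E(2) unfolding refl_on_def jump_def seqs_def by blast
  show "sym (jump E)" using E(3) unfolding sym_def jump_def by blast
  show "trans (jump E)"
  proof (rule transI)
    fix a b c assume ab: "(a, b) \<in> jump E" and bc: "(b, c) \<in> jump E"
    have "\<exists>m. (a n, c m) \<in> E" for n
    proof -
      obtain i where "(a n, b i) \<in> E" using ab unfolding jump_def by blast
      moreover obtain m where "(b i, c m) \<in> E" using bc unfolding jump_def by blast
      ultimately show ?thesis using transD[OF E(4)] by blast
    qed
    moreover have "\<exists>n. (a n, c m) \<in> E" for m
    proof -
      obtain i where "(b i, c m) \<in> E" using bc unfolding jump_def by blast
      moreover obtain n where "(a n, b i) \<in> E" using ab unfolding jump_def by blast
      ultimately show ?thesis using transD[OF E(4)] by blast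
    qed
    ultimately show "(a, c) \<in> jump E" unfolding jump_def by blast
  qed
qed

lemma equiv_E_tt: "equiv (seqs X) (E_tt X)"
proof (rule equivI)
  show "E_tt X \<subseteq> seqs X \<times> seqs X" unfolding E_tt_def by blast
  show "refl_on (seqs X) (E_tt X)" using E_tt_refl by (rule refl_onI)
  show "sym (E_tt X)" using E_tt_sym by (rule symI)
  show "trans (E_tt X)" using E_tt_trans by (rule transI)
qed

section \<open>The reduction\<close>

lemma dense_sequence:
  fixes A :: "'a::{metric_space, second_countable_topology} set"
  assumes "A \<noteq> {}"
  obtains q :: "nat \<Rightarrow> 'a" where "\<And>i. q i \<in> A" "\<And>x e. x \<in> A \<Longrightarrow> e > 0 \<Longrightarrow> \<exists>i. dist x (q i) < e"
proof -
  define \<U> where "\<U> = {U \<in> ubase. A \<inter> U \<noteq> {}}"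
  have "countable \<U>" unfolding \<U>_def using countable_ubase by (rule countable_subset[rotated]) blast
  obtain a where a: "a \<in> A" using assms by blast
  obtain V where "V \<in> ubase" "a \<in> V" by (rule ubase_point[OF open_UNIV UNIV_I[of a]])
  then have "\<U> \<noteq> {}" using a unfolding \<U>_def by blast
  have f: "\<exists>x. x \<in> A \<inter> U" if "U \<in> \<U>" for U using that unfolding \<U>_def by blast
  define q where "q i = (SOME x. x \<in> A \<inter> from_nat_into \<U> i)" for i
  have q: "q i \<in> A \<inter> from_nat_into \<U> i" for i
    unfolding q_def using someI_ex[OF f[OF from_nat_into[OF \<open>\<U> \<noteq> {}\<close>]]] .
  show thesis
  proof
    show "q i \<in> A" for i using q by blast
    fix x and e :: real assume "x \<in> A" "e > 0"
    then obtain U where U: "U \<in> ubase" "x \<in> U" "U \<subseteq> ball x e" using ubase_point[of "ball x e" x] by auto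
    then have "U \<in> \<U>" using \<open>x \<in> A\<close> unfolding \<U>_def by blast
    then obtain i where "from_nat_into \<U> i = U" using from_nat_into_surj[OF \<open>countable \<U>\<close>] by blast
    then have "q i \<in> ball x e" using q[of i] U(3) by auto
    then show "\<exists>i. dist x (q i) < e" by auto
  qed
qed

text \<open>The enumeration of thresholds and cuts is the same for all systems, so the list of
  orbits has a fixed index set.\<close>

definition index :: "nat \<Rightarrow> nat \<times> ((nat \<Rightarrow> real) set \<times> (nat \<Rightarrow> real) set)" where
  "index m = map_prod id (from_nat_into cuts) (prod_decode m)"

lemma index:
  "snd (index m) \<in> cuts" "a \<in> cuts \<Longrightarrow> \<exists>m. index m = (k, a)"
proof -
  have "({} :: (nat \<Rightarrow> real) set) \<in> ubase" unfolding ubase_def by (rule image_eqI[of _ _ "{}"]) auto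
  then have "(cuts :: ((nat \<Rightarrow> real) set \<times> (nat \<Rightarrow> real) set) set) \<noteq> {}"
    unfolding cuts_def by blast
  then show "snd (index m) \<in> cuts" unfolding index_def by (cases "prod_decode m") (simp add: from_nat_into)
  assume "a \<in> cuts"
  then obtain i where "from_nat_into cuts i = a" using from_nat_into_surj[OF countable_cuts] by blast
  then have "index (prod_encode (k, i)) = (k, a)" by (simp add: index_def)
  then show "\<exists>m. index m = (k, a)" ..
qed

text \<open>Entries \<open>0\<close> to \<open>n\<close> of the witness are an orbit segment; entry
  \<open>Suc n\<close> is the free place that stores the partner making the starting point big. The
  starting point is quantified, never chosen, and the tolerance tends to zero with
  \<open>n\<close>.\<close>

definition near_orbit ::
    "nat \<Rightarrow> (nat \<Rightarrow> real) set \<times> (nat \<Rightarrow> real) set \<Rightarrow> nat \<Rightarrow> (nat \<Rightarrow> real) \<Rightarrow> system_code \<Rightarrow> bool" where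
  "near_orbit k a n p c \<longleftrightarrow> (\<exists>z\<in>seqs hilbert_cube. connected_component (fst c) (z 0) (z (Suc n)) \<and>
     1 / Suc k \<le> dist (z 0) (z (Suc n)) \<and> z 0 \<notin> snd a \<and> (\<forall>i. i < n \<longrightarrow> (z i, z (Suc i)) \<in> snd c) \<and>
     dist (z n) p \<le> 1 / Suc n)"

lemma borelp_near_orbit: "a \<in> cuts \<Longrightarrow> borelp (near_orbit k a n p)"
  unfolding near_orbit_def[abs_def]
  by (intro borelp_wit closedp_conj closedp_connected closedp_dist_ge closedp_not_in open_cuts closedp_all
      closedp_imp closedp_in_snd closedp_dist_le)

lemma near_orbit_iff:
  assumes C: "C \<subseteq> hilbert_cube" "h ` C \<subseteq> C"
  shows "near_orbit k a n p (C, graph_on C h) \<longleftrightarrow> (\<exists>x\<in>big k C - snd a. dist ((h ^^ n) x) p \<le> 1 / Suc n)"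
proof
  assume "near_orbit k a n p (C, graph_on C h)"
  then obtain z where z: "connected_component C (z 0) (z (Suc n))" "1 / Suc k \<le> dist (z 0) (z (Suc n))"
     "z 0 \<notin> snd a" "\<And>i. i < n \<Longrightarrow> (z i, z (Suc i)) \<in> graph_on C h" "dist (z n) p \<le> 1 / Suc n"
    unfolding near_orbit_def by auto
  have "z n = (h ^^ n) (z 0)" using graph_chain[of n z C h n] z(4) by simp
  then show "\<exists>x\<in>big k C - snd a. dist ((h ^^ n) x) p \<le> 1 / Suc n"
    using z unfolding big_def by (intro bexI[of _ "z 0"]) auto
next
  assume "\<exists>x\<in>big k C - snd a. dist ((h ^^ n) x) p \<le> 1 / Suc n"
  then obtain x y where x: "connected_component C x y" "1 / Suc k \<le> dist x y" "x \<notin> snd a"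
    "dist ((h ^^ n) x) p \<le> 1 / Suc n" unfolding big_def by blast
  have xy: "x \<in> C" "y \<in> C" using connected_component_in[OF x(1)] by auto
  have "(h ^^ i) x \<in> C" for i using iterate_in[OF C(2) xy(1)] .
  then show "near_orbit k a n p (C, graph_on C h)"
    unfolding near_orbit_def using x xy C(1)
    by (intro bexI[of _ "\<lambda>i. if i \<le> n then (h ^^ i) x else y"]) (auto simp: graph_on_def seqs_def)
qed

text \<open>The sequence with index \<open>Suc m\<close> follows the orbit of the nondegenerate component selected by
  \<open>index m\<close>, up to an error tending to zero, through a countable dense set. If the index selects no
  component, the sequence is constant; a constant sequence is always present at index 0.\<close>

definition code_orbits :: "(nat \<Rightarrow> nat \<Rightarrow> real) \<Rightarrow> system_code \<Rightarrow> nat \<Rightarrow> nat \<Rightarrow> nat \<Rightarrow> real" where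
  "code_orbits q c m n = (case m of 0 \<Rightarrow> q 0 | Suc m' \<Rightarrow>
     if good (fst (index m')) (snd (index m')) (fst c) \<and> \<not> big (fst (index m')) (fst c) \<subseteq> snd (snd (index m'))
     then q (LEAST i. near_orbit (fst (index m')) (snd (index m')) n (q i) c) else q 0)"

lemma measurable_code_orbits: "code_orbits q \<in> borel_measurable (borel_of code_space)"
proof (intro measurable_coordinatewise_then_product)
  fix m n i
  show "(\<lambda>c. code_orbits q c m n i) \<in> borel_measurable (borel_of code_space)"
  proof (cases m)
    case 0
    then show ?thesis by (simp add: code_orbits_def)
  next
    case (Suc m')
    define k a where "k = fst (index m')" and "a = snd (index m')"
    have a: "a \<in> cuts" unfolding a_def by (rule index)
    have P: "borelp (\<lambda>c. good k a (fst c) \<and> \<not> big k (fst c) \<subseteq> snd a)"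
      by (intro borelp_conj borelp_good borelp_not borelp_big_subset open_cuts a)
    \<comment> \<open>The least admissible index depends measurably on the code: this is the Borel
      selection.\<close>
    have "(\<lambda>c. LEAST i. near_orbit k a n (q i) c) \<in> borel_of code_space \<rightarrow>\<^sub>M count_space UNIV"
      using borelp_near_orbit[OF a] by (intro measurable_Least)
    then have "(\<lambda>c. (\<lambda>j. q j i) (LEAST i. near_orbit k a n (q i) c)) \<in> borel_measurable (borel_of code_space)"
      by (rule measurable_compose) simp
    then have "(\<lambda>c. if good k a (fst c) \<and> \<not> big k (fst c) \<subseteq> snd a
        then q (LEAST i. near_orbit k a n (q i) c) i else q 0 i) \<in> borel_measurable (borel_of code_space)"
      using P unfolding pred_def by (intro measurable_If) simp_all
    moreover have "code_orbits q c m n i = (if good k a (fst c) \<and> \<not> big k (fst c) \<subseteq> snd a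
        then q (LEAST i. near_orbit k a n (q i) c) i else q 0 i)" for c
      unfolding Suc code_orbits_def k_def a_def by simp
    ultimately show ?thesis by simp
  qed
qed

lemma code_orbits_constant:
  assumes "m = 0 \<or> \<not> (good (fst (index (m - 1))) (snd (index (m - 1))) (fst c) \<and>
      \<not> big (fst (index (m - 1))) (fst c) \<subseteq> snd (snd (index (m - 1))))"
  shows "code_orbits q c m = (\<lambda>n. q 0)"
  using assms by (cases m) (auto simp: code_orbits_def fun_eq_iff)

text \<open>At each time \<open>n\<close> the approximated orbit starts at a possibly different
  \<open>y n\<close>, but \<open>good\<close> puts all of them into the component of
  \<open>x\<close>. So the distance between the two orbits at time \<open>n\<close> tends to zero,
  and the approximation error is at most \<open>1 / Suc n\<close>.\<close>

lemma code_orbits_orbit: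
  assumes q: "\<And>i. q i \<in> hilbert_cube" "\<And>x e. x \<in> hilbert_cube \<Longrightarrow> e > 0 \<Longrightarrow> \<exists>i. dist x (q i) < e"
    and C: "C \<subseteq> hilbert_cube" "tame_cantoroid C" "invertible_system C h" "minimal_system C h"
    and m: "index m = (k, a)" and g: "good k a C" and x: "x \<in> big k C - snd a"
  shows "(code_orbits q (C, graph_on C h) (Suc m), \<lambda>n. (h ^^ n) x) \<in> E_tt hilbert_cube"
proof -
  let ?f = "code_orbits q (C, graph_on C h) (Suc m)"
  note mD = minimal_systemD[OF C(4)]
  have xC: "x \<in> C" using x big_subset by blast
  have f: "?f n = q (LEAST i. near_orbit k a n (q i) (C, graph_on C h))" for n
    using g x by (auto simp: code_orbits_def m)
  have "\<exists>y. y \<in> big k C - snd a \<and> dist ((h ^^ n) y) (?f n) \<le> 1 / Suc n" for n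
  proof -
    have "(h ^^ n) x \<in> hilbert_cube" using mD(4)[OF xC] C(1) by blast
    then obtain i where "dist ((h ^^ n) x) (q i) < 1 / Suc n" using q(2)[of _ "1 / Suc n"] by auto
    then have "near_orbit k a n (q i) (C, graph_on C h)"
      unfolding near_orbit_iff[OF C(1) mD(3)] using x less_imp_le by blast
    then have "near_orbit k a n (?f n) (C, graph_on C h)" unfolding f by (rule LeastI)
    then show ?thesis unfolding near_orbit_iff[OF C(1) mD(3)] by blast
  qed
  then obtain y where y: "\<And>n. y n \<in> big k C - snd a" "\<And>n. dist ((h ^^ n) (y n)) (?f n) \<le> 1 / Suc n" by metis
  have "connected_component C x (y n)" for n using g x y(1) unfolding good_def by blast
  then have null: "(\<lambda>n. dist ((h ^^ n) x) ((h ^^ n) (y n))) \<longlonglongrightarrow> 0"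
    by (rule component_orbit_null[OF C(2-4)])
  have lim: "(\<lambda>n. 1 / real (Suc n) + dist ((h ^^ n) x) ((h ^^ n) (y n))) \<longlonglongrightarrow> 0"
    using lim_inverse_n'[THEN LIMSEQ_Suc] null by (intro tendsto_add_zero) simp_all
  have "dist (?f n) ((h ^^ n) x) \<le> 1 / real (Suc n) + dist ((h ^^ n) x) ((h ^^ n) (y n))" for n
    using dist_triangle[of "?f n" "(h ^^ n) x" "(h ^^ n) (y n)"] y(2)[of n] by (simp add: dist_commute)
  then have "(\<lambda>n. dist (?f n) ((h ^^ n) x)) \<longlonglongrightarrow> 0"
    by (intro tendsto_sandwich[OF _ _ tendsto_const lim] always_eventually) simp_all
  then show ?thesis
    using q(1) mD(4)[OF xC] C(1) by (intro E_tt_asymptotic seqsI) (auto simp: f)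
qed

lemma code_orbits_in: "(\<And>i. q i \<in> A) \<Longrightarrow> code_orbits q c \<in> seqs (seqs A)"
  by (auto simp: seqs_def code_orbits_def split: nat.split)

lemma code_orbits_cover:
  assumes "tame_cantoroid C" "x \<in> big k C"
  obtains m a where "index m = (k, a)" "good k a C" "x \<in> big k C - snd a"
proof -
  have C: "compact C" "finite {D \<in> components C. diameter D \<ge> 1 / Suc k}"
    using assms(1) unfolding tame_cantoroid_def cantoroid_def
    by (auto simp del: of_nat_Suc)
  obtain a where a: "a \<in> cuts" "good k a C" "x \<in> fst a" using big_isolated[OF C assms(2)] .
  then have "x \<notin> snd a" using cutsD(3)[of "fst a" "snd a"] by auto
  moreover obtain m where "index m = (k, a)" using index(2)[OF a(1)] by blast
  ultimately show thesis using that a(2) assms(2) by blast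
qed

text \<open>A homeomorphism maps nondegenerate components to nondegenerate ones, but may change
  their size; hence a new threshold \<open>k'\<close> and a new cut are found for the image.\<close>

lemma code_orbits_conjugate:
  assumes q: "\<And>i. q i \<in> hilbert_cube" "\<And>x e. x \<in> hilbert_cube \<Longrightarrow> e > 0 \<Longrightarrow> \<exists>i. dist x (q i) < e"
    and cd: "(c, d) \<in> conjugacy"
  shows "\<exists>m'. (code_orbits q c m, code_orbits q d m') \<in> E_tt hilbert_cube"
proof (cases "m = 0 \<or> \<not> (good (fst (index (m - 1))) (snd (index (m - 1))) (fst c) \<and>
      \<not> big (fst (index (m - 1))) (fst c) \<subseteq> snd (snd (index (m - 1))))")
  case True
  \<comment> \<open>A filler is matched by entry \<open>0\<close> of the other list.\<close>
  have "code_orbits q c m = code_orbits q d 0"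
    using code_orbits_constant[OF True] code_orbits_constant[of 0 d q] by simp
  then show ?thesis using E_tt_refl[OF seqsD[OF code_orbits_in[of q, OF q(1)]]] by metis
next
  case False
  then obtain m1 where m1: "m = Suc m1" by (cases m) auto
  obtain k a where ka: "index m1 = (k, a)" by (cases "index m1")
  have "c \<in> minimal_tame_codes" "d \<in> minimal_tame_codes" using cd unfolding conjugacy_def by auto
  then obtain C h D l where c: "c = (C, graph_on C h)" and C: "C \<subseteq> hilbert_cube" "tame_cantoroid C"
      "invertible_system C h" "minimal_system C h"
    and d: "d = (D, graph_on D l)" and D: "D \<subseteq> hilbert_cube" "tame_cantoroid D"
      "invertible_system D l" "minimal_system D l"
    by (elim minimal_tame_codesE)
  have g: "good k a C" "\<not> big k C \<subseteq> snd a" using False unfolding m1 c by (simp_all add: ka)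
  then obtain x where x: "x \<in> big k C - snd a" by blast
  have "conjugate_systems C h D l" using cd unfolding c d conjugacy_iff by blast
  then obtain \<phi> \<psi> where \<phi>: "homeomorphism C D \<phi> \<psi>" "\<And>x. x \<in> C \<Longrightarrow> \<phi> (h x) = l (\<phi> x)"
    unfolding conjugate_systems_def by blast
  obtain y where y: "connected_component C x y" "1 / Suc k \<le> dist x y" using x unfolding big_def by blast
  have xy: "x \<in> C" "y \<in> C" "x \<noteq> y" using connected_component_in[OF y(1)] y(2) by (auto simp: not_le)
  have "connected_component D (\<phi> x) (\<phi> y)"
    using connected_component_image[OF y(1) homeomorphism_cont1[OF \<phi>(1)]] homeomorphism_image1[OF \<phi>(1)] by simp
  moreover have "\<phi> x \<noteq> \<phi> y" using homeomorphism_apply1[OF \<phi>(1)] xy by metis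
  ultimately obtain k' where "\<phi> x \<in> big k' D" by (rule nondegenerate_big)
  then obtain m' a' where m': "index m' = (k', a')" "good k' a' D" "\<phi> x \<in> big k' D - snd a'"
    using code_orbits_cover[OF D(2)] by blast
  have 1: "(code_orbits q c m, \<lambda>n. (h ^^ n) x) \<in> E_tt hilbert_cube"
    unfolding m1 c using code_orbits_orbit[OF q C ka g(1) x] .
  have 2: "(\<lambda>n. (h ^^ n) x, \<lambda>n. (l ^^ n) (\<phi> x)) \<in> E_tt hilbert_cube"
    using E_tt_conjugate[OF \<phi> C(4,1) D(4,1) xy(1)] .
  have 3: "(code_orbits q d (Suc m'), \<lambda>n. (l ^^ n) (\<phi> x)) \<in> E_tt hilbert_cube"
    unfolding d using code_orbits_orbit[OF q D m'] .
  show ?thesis using E_tt_trans[OF E_tt_trans[OF 1 2] E_tt_sym[OF 3]] by blast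
qed

text \<open>One matched orbit is enough for a conjugacy. Since \<open>C\<close> is not the Cantor
  space, its list has a genuine orbit, and the partner in the list of \<open>d\<close> is either a
  filler, which is excluded, or an orbit.\<close>

lemma conjugacy_of_code_orbits:
  assumes q: "\<And>i. q i \<in> hilbert_cube" "\<And>x e. x \<in> hilbert_cube \<Longrightarrow> e > 0 \<Longrightarrow> \<exists>i. dist x (q i) < e"
    and cd: "c \<in> minimal_tame_codes" "d \<in> minimal_tame_codes"
    and j: "(code_orbits q c, code_orbits q d) \<in> jump (E_tt hilbert_cube)"
  shows "(c, d) \<in> conjugacy"
proof -
  obtain C h D l where c: "c = (C, graph_on C h)" and C: "C \<subseteq> hilbert_cube" "tame_cantoroid C"
      "invertible_system C h" "minimal_system C h" and nC: "\<not> C homeomorphic cantor_space"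
    and d: "d = (D, graph_on D l)" and D: "D \<subseteq> hilbert_cube" "tame_cantoroid D"
      "invertible_system D l" "minimal_system D l"
    using cd by (elim minimal_tame_codesE)
  note mC = minimal_systemD[OF C(4)]
  have "C \<noteq> {}" "\<nexists>x. x isolated_in C" using C(2) unfolding tame_cantoroid_def cantoroid_def by blast+
  then obtain k x where xb: "x \<in> big k C" using not_cantor_space_iff[OF mC(1)] nC by blast
  obtain y where y: "connected_component C x y" "1 / Suc k \<le> dist x y" using xb unfolding big_def by blast
  have xy: "x \<in> C" "y \<in> C" "x \<noteq> y" using connected_component_in[OF y(1)] y(2) by (auto simp: not_le)
  obtain m a where m: "index m = (k, a)" "good k a C" "x \<in> big k C - snd a"
    using code_orbits_cover[OF C(2) xb] .
  have 1: "(code_orbits q c (Suc m), \<lambda>n. (h ^^ n) x) \<in> E_tt hilbert_cube"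
    unfolding c using code_orbits_orbit[OF q C m] .
  obtain m' where 2: "(code_orbits q c (Suc m), code_orbits q d m') \<in> E_tt hilbert_cube"
    using j unfolding jump_def by blast
  have 3: "(\<lambda>n. (h ^^ n) x, code_orbits q d m') \<in> E_tt hilbert_cube"
    using E_tt_trans[OF E_tt_sym[OF 1] 2] .
  have "\<not> (m' = 0 \<or> \<not> (good (fst (index (m' - 1))) (snd (index (m' - 1))) (fst d) \<and>
      \<not> big (fst (index (m' - 1))) (fst d) \<subseteq> snd (snd (index (m' - 1)))))" (is "\<not> ?const")
  proof
    assume ?const
    then have "code_orbits q d m' = (\<lambda>n. q 0)" by (rule code_orbits_constant)
    then have "(\<lambda>n. (h ^^ n) x, \<lambda>n. q 0) \<in> E_tt hilbert_cube" using 3 by simp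
    \<comment> \<open>The constant sequence converges along the identity subsequence, so the whole
      orbit of \<open>x\<close> would converge and \<open>C\<close> would be a point.\<close>
    moreover have "((\<lambda>n. q 0) \<circ> id) \<longlonglongrightarrow> q 0" by (simp add: o_def)
    moreover have "strict_mono (id :: nat \<Rightarrow> nat)" by (simp add: strict_mono_def)
    ultimately obtain p where "((\<lambda>n. (h ^^ n) x) \<circ> id) \<longlonglongrightarrow> p"
      using q(1) unfolding E_tt_def by blast
    then have "C \<subseteq> {p}" using minimal_orbit_convergent[OF C(4) xy(1)] by (simp add: o_def)
    then show False using xy by blast
  qed
  then obtain m1 where m1: "m' = Suc m1" and
    good: "good (fst (index m1)) (snd (index m1)) D" "\<not> big (fst (index m1)) D \<subseteq> snd (snd (index m1))"
    unfolding d by (cases m') auto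
  obtain k' a' where ka: "index m1 = (k', a')" by (cases "index m1")
  obtain u where u: "u \<in> big k' D - snd a'" using good(2) unfolding ka by auto
  have uD: "u \<in> D" using u big_subset by blast
  have "(code_orbits q d m', \<lambda>n. (l ^^ n) u) \<in> E_tt hilbert_cube"
    unfolding m1 d using code_orbits_orbit[OF q D ka _ u] good(1) by (simp add: ka)
  then have "(\<lambda>n. (h ^^ n) x, \<lambda>n. (l ^^ n) u) \<in> E_tt hilbert_cube" using E_tt_trans[OF 3] by blast
  then have "conjugate_systems C h D l" using conjugate_of_E_tt[OF C(4,1) D(4,1) xy(1) uD] by blast
  then show ?thesis using cd unfolding c d conjugacy_iff by blast
qed

lemma measurable_borel_of_top_of_set:
  assumes "f \<in> borel_measurable M" "f \<in> space M \<rightarrow> S"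
  shows "f \<in> M \<rightarrow>\<^sub>M borel_of (top_of_set S)"
  unfolding borel_of_def
proof (rule measurable_measure_of)
  show "{U. openin (top_of_set S) U} \<subseteq> Pow (topspace (top_of_set S))" using openin_imp_subset by auto
  show "f \<in> space M \<rightarrow> topspace (top_of_set S)" using assms(2) by simp
  fix U assume "U \<in> {U. openin (top_of_set S) U}"
  then obtain T where T: "open T" "U = S \<inter> T" unfolding openin_open by blast
  then have "f -` U \<inter> space M = f -` T \<inter> space M" using assms(2) by auto
  then show "f -` U \<inter> space M \<in> sets M" using measurable_sets[OF assms(1) borel_open[OF T(1)]] by simp
qed

theorem theorem4p6:
  shows "borel_reducible
           code_space minimal_tame_codes conjugacy
           (top_of_set (seqs (seqs hilbert_cube))) (seqs (seqs hilbert_cube))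
           (jump (E_tt hilbert_cube))"
proof -
  let ?S = "seqs (seqs hilbert_cube)"
  let ?Y = "borel_of (top_of_set ?S)"
  have "hilbert_cube \<noteq> {}" using hilbert_cube_nonempty by blast
  then obtain q :: "nat \<Rightarrow> nat \<Rightarrow> real"
    where q: "\<And>i. q i \<in> hilbert_cube" "\<And>x e. x \<in> hilbert_cube \<Longrightarrow> e > 0 \<Longrightarrow> \<exists>i. dist x (q i) < e"
    using dense_sequence[of hilbert_cube] by metis
  have in_S: "code_orbits q c \<in> ?S" for c by (rule code_orbits_in[OF q(1)])
  have S: "?S \<in> sets ?Y"
    using sets.top[of ?Y] by (simp add: space_borel_of)
  have "code_orbits q \<in> borel_of code_space \<rightarrow>\<^sub>M ?Y"
    using measurable_code_orbits in_S by (intro measurable_borel_of_top_of_set) auto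
  then have meas: "code_orbits q \<in> restrict_space (borel_of code_space) minimal_tame_codes \<rightarrow>\<^sub>M restrict_space ?Y ?S"
    using in_S by (intro measurable_restrict_space2 measurable_restrict_space1) auto
  have "(c, d) \<in> conjugacy \<longleftrightarrow> (code_orbits q c, code_orbits q d) \<in> jump (E_tt hilbert_cube)"
    if "c \<in> minimal_tame_codes" "d \<in> minimal_tame_codes" for c d
  proof
    assume cd: "(c, d) \<in> conjugacy"
    \<comment> \<open>Matching is shown from \<open>c\<close> to \<open>d\<close> only; the second
      clause of the jump comes from the reversed conjugacy.\<close>
    then have dc: "(d, c) \<in> conjugacy" using equiv_conjugacy by (meson equivE symD)
    show "(code_orbits q c, code_orbits q d) \<in> jump (E_tt hilbert_cube)"
      unfolding jump_def using code_orbits_conjugate[OF q cd] code_orbits_conjugate[OF q dc] E_tt_sym by blast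
  qed (rule conjugacy_of_code_orbits[OF q that])
  then show ?thesis
    unfolding borel_reducible_def
    using minimal_tame_codes_borel S equiv_conjugacy equiv_jump[OF equiv_E_tt] meas by blast
qed

end
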